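(* Let $A_4$ be the 2-state Mealy automaton over the 4-symbol alphabet $\{x_0,x_1,x_2,x_3\}$ whose automatic transformations have the unrolled forms $$f_0=(f_0,f_0,f_0,f_0)(x_0,x_0,x_1,x_1),\qquad f_1=(f_0,f_1,f_1,f_1)(x_2,x_3,x_0,x_1).$$ Then: (1) The semigroup $S_{A_4}$ generated by $f_0,f_1$ is infinitely presented (it admits no finite presentation), and it has the semigroup presentation with generators $f_0,f_1$ and defining relations $$f_0^2f_i=f_0^2,\qquad f_1f_0f_1^2f_i=f_1f_0f_i\quad (i=0,1),\qquad f_0f_1^{2p+1}f_0=f_0f_1f_0\quad (p\ge 1).$$ (2) The growth function $\gamma_{A_4}$ of $A_4$ is a composite (for $k=2$) non-monotonic function, given by $$\gamma_{A_4}(2n)=4n^2-5n+6\ \text{ for } n\ge 2,\qquad \gamma_{A_4}(2n+1)=\tfrac72n^2+\tfrac32n+2\ \text{ for } n\ge 0,$$ and $\gamma_{A_4}(2)=4$. The function $\gamma_{A_4}$ has the square growth order $[n^2]$.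
   Context: A Mealy automaton with states $q_0,\dots,q_{n-1}$ and input/output alphabet $X_m=\{x_0,\dots,x_{m-1}\}$ has a transition function $\pi:X_m\times Q\to Q$ and an output function $\lambda:X_m\times Q\to X_m$. The state $q_i$ defines an automatic transformation $f_i=f_{q_i}$ of the set of finite (or infinite) words over $X_m$: on input $x u$ ($x$ a letter) it outputs $\lambda(x,q_i)$ followed by $f_{\pi(x,q_i)}(u)$. The unrolled form $f_i=(g_0,\dots,g_{m-1})(y_0,\dots,y_{m-1})$ means $f_i(x_ju)=y_j\,g_j(u)$ for every letter $x_j$ and word $u$. Products of transformations are compositions applied from right to left: $(fg)(u)=f(g(u))$. $S_A$ is the semigroup generated by the automatic transformations $f_0,\dots,f_{n-1}$ under composition. The growth function of $A$ is $\gamma_A(n)=|Q_{A^{(n)}}|$, the number of states of the minimal automaton equivalent to the $n$-th power $A^n$ (sequential application); equivalently, for $n\ge1$, $\gamma_A(n)$ is the number of distinct transformations of the form $f_{i_1}f_{i_2}\cdots f_{i_n}$ (products of exactly $n$ generators). A function $\gamma$ is called composite for $k\geq 2$ if at least two of the functions $n\mapsto\gamma(kn+i)$, $0\le i<k$, are given by different expressions; for $k=2$ here this is witnessed by the two displayed formulas for even and odd arguments. Non-monotonic means neither non-decreasing nor non-increasing. Growth orders: for $\gamma_1,\gamma_2:\mathbb N\to\mathbb N$ write $\gamma_1\preceq\gamma_2$ if there are $C_1,C_2,N_0\in\mathbb N$ with $\gamma_1(n)\le C_1\gamma_2(C_2n)$ for all $n\ge N_0$; $\gamma_1\sim\gamma_2$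 if $\gamma_1\preceq\gamma_2$ and $\gamma_2\preceq\gamma_1$; the growth order $[\gamma]$ is the $\sim$-class of $\gamma$. *)

theory Defs
  imports Complex_Main
begin

section \<open>Mealy automata\<close>

text \<open>The alphabet is a finite type. The states form a finite subset of a type, so that
  powers of an automaton are again automata.\<close>

record ('q, 'x) mealy =
  states :: "'q set"
  trans :: "'x \<Rightarrow> 'q \<Rightarrow> 'q"
  out :: "'x \<Rightarrow> 'q \<Rightarrow> 'x"

definition mealy_automaton :: "('q, 'x::finite) mealy \<Rightarrow> bool" where
  "mealy_automaton A \<longleftrightarrow> finite (states A) \<and> states A \<noteq> {} \<and>
     (\<forall>x. \<forall>q \<in> states A. trans A x q \<in> states A)"

fun transf :: "('q, 'x::finite) mealy \<Rightarrow> 'q \<Rightarrow> 'x list \<Rightarrow> 'x list" where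
  "transf A q [] = []"
| "transf A q (x # u) = out A x q # transf A (trans A x q) u"

definition transf_set :: "('q, 'x::finite) mealy \<Rightarrow> ('x list \<Rightarrow> 'x list) set" where
  "transf_set A = transf A ` states A"

definition equivalent_automata :: "('q, 'x::finite) mealy \<Rightarrow> ('r, 'x) mealy \<Rightarrow> bool" where
  "equivalent_automata A B \<longleftrightarrow> transf_set A = transf_set B"

text \<open>The state \<open>[q\<^sub>1, \<dots>, q\<^sub>n]\<close> of the \<open>n\<close>-th power stands for the product
  \<open>f\<^bsub>q\<^sub>1\<^esub> \<cdots> f\<^bsub>q\<^sub>n\<^esub>\<close>, which is applied from right to left: the input letter
  is read by \<open>q\<^sub>n\<close>, whose output is read by \<open>q\<^bsub>n-1\<^esub>\<close>, and so on.\<close>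

fun seq_out :: "('q, 'x::finite) mealy \<Rightarrow> 'x \<Rightarrow> 'q list \<Rightarrow> 'x" where
  "seq_out A x [] = x"
| "seq_out A x (q # qs) = out A (seq_out A x qs) q"

fun seq_trans :: "('q, 'x::finite) mealy \<Rightarrow> 'x \<Rightarrow> 'q list \<Rightarrow> 'q list" where
  "seq_trans A x [] = []"
| "seq_trans A x (q # qs) = trans A (seq_out A x qs) q # seq_trans A x qs"

definition power_automaton :: "('q, 'x::finite) mealy \<Rightarrow> nat \<Rightarrow> ('q list, 'x) mealy" where
  "power_automaton A n =
     \<lparr>states = {qs. length qs = n \<and> set qs \<subseteq> states A},
      trans = seq_trans A, out = seq_out A\<rparr>"

text \<open>The number of states of the minimal automaton equivalent to \<open>A\<close>. An automaton has finitely
  many states, so taking them in \<^typ>\<open>nat\<close> is no restriction.\<close>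

definition minimal_state_count :: "('q, 'x::finite) mealy \<Rightarrow> nat" where
  "minimal_state_count A =
     (LEAST k. \<exists>B :: (nat, 'x) mealy.
        mealy_automaton B \<and> equivalent_automata B A \<and> card (states B) = k)"

definition growth_function :: "('q, 'x::finite) mealy \<Rightarrow> nat \<Rightarrow> nat" where
  "growth_function A n = minimal_state_count (power_automaton A n)"

inductive_set generated_semigroup :: "('s \<Rightarrow> 's \<Rightarrow> 's) \<Rightarrow> 's set \<Rightarrow> 's set"
  for mult :: "'s \<Rightarrow> 's \<Rightarrow> 's" and G :: "'s set" where
  gen: "g \<in> G \<Longrightarrow> g \<in> generated_semigroup mult G"
| mult: "a \<in> generated_semigroup mult G \<Longrightarrow> b \<in> generated_semigroup mult G
    \<Longrightarrow> mult a b \<in> generated_semigroup mult G"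

definition automaton_semigroup :: "('q, 'x::finite) mealy \<Rightarrow> ('x list \<Rightarrow> 'x list) set" where
  "automaton_semigroup A = generated_semigroup (\<circ>) (transf_set A)"


section \<open>Semigroup presentations\<close>

definition sg_words :: "'g set \<Rightarrow> 'g list set" where
  "sg_words G = {w. w \<noteq> [] \<and> set w \<subseteq> G}"

inductive_set sg_congruence :: "'g set \<Rightarrow> ('g list \<times> 'g list) set \<Rightarrow> ('g list \<times> 'g list) set"
  for G :: "'g set" and R :: "('g list \<times> 'g list) set" where
  base: "(u, v) \<in> R \<Longrightarrow> (u, v) \<in> sg_congruence G R"
| refl: "u \<in> sg_words G \<Longrightarrow> (u, u) \<in> sg_congruence G R"
| sym: "(u, v) \<in> sg_congruence G R \<Longrightarrow> (v, u) \<in> sg_congruence G R"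
| trans: "(u, v) \<in> sg_congruence G R \<Longrightarrow> (v, w) \<in> sg_congruence G R
    \<Longrightarrow> (u, w) \<in> sg_congruence G R"
| left: "(u, v) \<in> sg_congruence G R \<Longrightarrow> w \<in> sg_words G \<Longrightarrow> (w @ u, w @ v) \<in> sg_congruence G R"
| right: "(u, v) \<in> sg_congruence G R \<Longrightarrow> w \<in> sg_words G \<Longrightarrow> (u @ w, v @ w) \<in> sg_congruence G R"

text \<open>The semigroup \<open>S\<close> with multiplication \<open>mult\<close> has the presentation with generators \<open>G\<close> and
  defining relations \<open>R\<close>, where \<open>\<phi> g\<close> is the element of \<open>S\<close> denoted by the generator \<open>g\<close>:
  \<open>h\<close> is an isomorphism from the quotient of the free semigroup on \<open>G\<close>.\<close>

definition has_sg_presentation ::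
  "'s set \<Rightarrow> ('s \<Rightarrow> 's \<Rightarrow> 's) \<Rightarrow> ('g \<Rightarrow> 's) \<Rightarrow> 'g set \<Rightarrow> ('g list \<times> 'g list) set \<Rightarrow> bool" where
  "has_sg_presentation S mult \<phi> G R \<longleftrightarrow>
     R \<subseteq> sg_words G \<times> sg_words G \<and>
     (\<exists>h. bij_betw h (sg_words G // sg_congruence G R) S \<and>
        (\<forall>u \<in> sg_words G. \<forall>v \<in> sg_words G.
           h (sg_congruence G R `` {u @ v}) =
             mult (h (sg_congruence G R `` {u})) (h (sg_congruence G R `` {v}))) \<and>
        (\<forall>g \<in> G. h (sg_congruence G R `` {[g]}) = \<phi> g))"

text \<open>A finite set of generator symbols can be taken in \<^typ>\<open>nat\<close> without loss of generality.\<close>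

definition finitely_presented_sg :: "'s set \<Rightarrow> ('s \<Rightarrow> 's \<Rightarrow> 's) \<Rightarrow> bool" where
  "finitely_presented_sg S mult \<longleftrightarrow>
     (\<exists>(\<phi> :: nat \<Rightarrow> 's) G R. finite G \<and> finite R \<and> has_sg_presentation S mult \<phi> G R)"


section \<open>Growth\<close>

text \<open>Two functions are given by different expressions when no expression can describe both
  of them; as expressions may fail for finitely many arguments, this means that the functions
  are not eventually equal.\<close>

definition composite_function :: "nat \<Rightarrow> (nat \<Rightarrow> nat) \<Rightarrow> bool" where
  "composite_function k \<gamma> \<longleftrightarrow> k \<ge> 2 \<and>
     (\<exists>i < k. \<exists>j < k. \<not> eventually (\<lambda>n. \<gamma> (k * n + i) = \<gamma> (k * n + j)) sequentially)"

definition growth_le :: "(nat \<Rightarrow> nat) \<Rightarrow> (nat \<Rightarrow> nat) \<Rightarrow> bool" where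
  "growth_le \<gamma>1 \<gamma>2 \<longleftrightarrow>
     (\<exists>C1 > 0. \<exists>C2 > 0. \<exists>N0. \<forall>n \<ge> N0. \<gamma>1 n \<le> C1 * \<gamma>2 (C2 * n))"

definition growth_equiv :: "(nat \<Rightarrow> nat) \<Rightarrow> (nat \<Rightarrow> nat) \<Rightarrow> bool" where
  "growth_equiv \<gamma>1 \<gamma>2 \<longleftrightarrow> growth_le \<gamma>1 \<gamma>2 \<and> growth_le \<gamma>2 \<gamma>1"

definition growth_order :: "(nat \<Rightarrow> nat) \<Rightarrow> (nat \<Rightarrow> nat) set" where
  "growth_order \<gamma> = {\<delta>. growth_equiv \<gamma> \<delta>}"


section \<open>The automaton \<open>A\<^sub>4\<close>\<close>

datatype letter = X0 | X1 | X2 | X3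

instance letter :: finite
proof
  have "(UNIV :: letter set) = {X0, X1, X2, X3}"
    using letter.exhaust by auto
  then show "finite (UNIV :: letter set)"
    by (metis finite.emptyI finite.insertI)
qed

datatype state = Q0 | Q1

fun A4_trans :: "letter \<Rightarrow> state \<Rightarrow> state" where
  "A4_trans x Q0 = Q0"
| "A4_trans X0 Q1 = Q0"
| "A4_trans X1 Q1 = Q1"
| "A4_trans X2 Q1 = Q1"
| "A4_trans X3 Q1 = Q1"

fun A4_out :: "letter \<Rightarrow> state \<Rightarrow> letter" where
  "A4_out X0 Q0 = X0"
| "A4_out X1 Q0 = X0"
| "A4_out X2 Q0 = X1"
| "A4_out X3 Q0 = X1"
| "A4_out X0 Q1 = X2"
| "A4_out X1 Q1 = X3"
| "A4_out X2 Q1 = X0"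
| "A4_out X3 Q1 = X1"

definition A4 :: "(state, letter) mealy" where
  "A4 = \<lparr>states = {Q0, Q1}, trans = A4_trans, out = A4_out\<rparr>"

lemma A4_mealy_automaton: "mealy_automaton A4"
  by (simp add: mealy_automaton_def A4_def) (metis state.exhaust)

lemma A4_unrolled:
  "transf A4 Q0 (X0 # u) = X0 # transf A4 Q0 u"
  "transf A4 Q0 (X1 # u) = X0 # transf A4 Q0 u"
  "transf A4 Q0 (X2 # u) = X1 # transf A4 Q0 u"
  "transf A4 Q0 (X3 # u) = X1 # transf A4 Q0 u"
  "transf A4 Q1 (X0 # u) = X2 # transf A4 Q0 u"
  "transf A4 Q1 (X1 # u) = X3 # transf A4 Q1 u"
  "transf A4 Q1 (X2 # u) = X0 # transf A4 Q1 u"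
  "transf A4 Q1 (X3 # u) = X1 # transf A4 Q1 u"
  by (simp_all add: A4_def)

definition A4_relations :: "(state list \<times> state list) set" where
  "A4_relations =
     {([Q0, Q0, q], [Q0, Q0]) | q. q \<in> {Q0, Q1}} \<union>
     {([Q1, Q0, Q1, Q1, q], [Q1, Q0, q]) | q. q \<in> {Q0, Q1}} \<union>
     {([Q0] @ replicate (2 * p + 1) Q1 @ [Q0], [Q0, Q1, Q0]) | p. p \<ge> 1}"

end

theory Submission
  imports Defs "HOL-Library.Stream"
begin

text \<open>Reading the relations from left to right rewrites every word to one of the normal forms
  \<open>1\<^sup>a\<close>, \<open>01\<^sup>b\<close>, \<open>00\<close>, \<open>1\<^sup>a (10)\<^sup>k t\<close>, \<open>0(10)\<^sup>k t\<close>, \<open>01\<^bsup>2c+1\<^esup>(10)\<^sup>k t\<close> with \<open>k \<ge> 1\<close> and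
  \<open>t \<in> {\<epsilon>, 0, 1, 11}\<close>, and the actions on the infinite words \<open>0\<^sup>\<omega>\<close>, \<open>20\<^sup>\<omega>\<close>, \<open>220\<^sup>\<omega>\<close> tell these normal
  forms apart. So the relations present the semigroup. The relations preserve the parity of the
  length, except that \<open>00\<close> absorbs any number of letters on its right; this determines the normal
  forms of products of exactly \<open>n\<close> generators. No finite subset of the relations suffices,
  since for \<open>p \<ge> 1\<close> the only relation with a side occurring in \<open>01\<^bsup>2p+1\<^esup>0\<close> is the one with
  exponent \<open>2p+1\<close>.\<close>

section \<open>Automata and their transformations\<close>

primrec act :: "('q, 'x::finite) mealy \<Rightarrow> 'q list \<Rightarrow> 'x list \<Rightarrow> 'x list" where
  "act A [] = id"
| "act A (q # w) = transf A q \<circ> act A w"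

lemma act_append: "act A (v @ w) = act A v \<circ> act A w"
  by (induction v) auto

lemma length_transf [simp]: "length (transf A q u) = length u"
  by (induction u arbitrary: q) auto

lemma length_act [simp]: "length (act A w u) = length u"
  by (induction w) auto

text \<open>The transition and output functions of the power automaton do not depend on
  \<open>n\<close>, so the identity holds for words of every length, and induction on
  \<open>w\<close> peels off one factor at a time.\<close>

lemma transf_power: "transf (power_automaton A n) w = act A w"
proof
  fix u
  have "transf (power_automaton A n) [] u = u" for u
    by (induction u) (auto simp: power_automaton_def)
  moreover have "transf (power_automaton A n) (q # w) u
      = transf A q (transf (power_automaton A n) w u)" for q w u
    by (induction u arbitrary: q w) (auto simp: power_automaton_def)
  ultimately show "transf (power_automaton A n) w u = act A w u"
    by (induction w) auto
qed

lemma mealy_automaton_power: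
  assumes "mealy_automaton A"
  shows "mealy_automaton (power_automaton A n)"
proof -
  have "length (seq_trans A x w) = length w" for x w
    by (induction w) auto
  moreover have "set (seq_trans A x w) \<subseteq> states A" if "set w \<subseteq> states A" for x w
    using that assms by (induction w) (auto simp: mealy_automaton_def)
  moreover have "finite {w. length w = n \<and> set w \<subseteq> states A}"
    using finite_lists_length_eq[of "states A" n] assms
    by (simp add: mealy_automaton_def conj_commute)
  moreover obtain q where "q \<in> states A"
    using assms by (auto simp: mealy_automaton_def)
  then have "length (replicate n q) = n \<and> set (replicate n q) \<subseteq> states A"
    by auto
  then have "{w. length w = n \<and> set w \<subseteq> states A} \<noteq> {}"
    by blast
  ultimately show ?thesis
    by (simp add: mealy_automaton_def power_automaton_def)
qed

text \<open>No equivalent automaton has fewer states, since its states map onto the set of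
  transformations. Conversely this set is closed under passing to sections, so it can itself serve
  as a set of states.\<close>

lemma minimal_state_count_eq:
  fixes A :: "('q, 'x::finite) mealy"
  assumes A: "mealy_automaton A"
  shows "minimal_state_count A = card (transf_set A)"
proof -
  have fin: "finite (transf_set A)"
    using A by (auto simp: mealy_automaton_def transf_set_def)
  obtain e where e: "bij_betw e {0..<card (transf_set A)} (transf_set A)"
    using ex_bij_betw_nat_finite[OF fin] by blast
  define S where "S = {0..<card (transf_set A)}"
  define d where "d = inv_into S e"
  have e_S: "e i \<in> transf_set A" if "i \<in> S" for i
    using e that by (auto simp: S_def bij_betw_def)
  have d_S: "d f \<in> S" "e (d f) = f" if "f \<in> transf_set A" for f
    using e that unfolding d_def S_def bij_betw_def
    by (metis inv_into_into, metis f_inv_into_f)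
  \<comment> \<open>The states number the transformations via \<open>e\<close>. On \<open>x\<close>
    the transformation \<open>f\<close> passes to its section, which maps \<open>u\<close> to
    \<open>tl (f (x # u))\<close>; its output is the value on the one-letter word.\<close>
  define B :: "(nat, 'x) mealy" where
    "B = \<lparr>states = S, trans = (\<lambda>x i. d (\<lambda>u. tl (e i (x # u)))), out = (\<lambda>x i. hd (e i [x]))\<rparr>"
  have sec: "(\<lambda>u. tl (f (x # u))) \<in> transf_set A" if "f \<in> transf_set A" for f x
    using that A unfolding transf_set_def mealy_automaton_def by fastforce
  have B_transf: "transf B i u = e i u" if "i \<in> S" for i u
    using that
  proof (induction u arbitrary: i)
    case Nil
    then show ?case using e_S[of i] by (auto simp: transf_set_def)
  next
    case (Cons x u)
    obtain q where q: "q \<in> states A" "e i = transf A q"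
      using e_S[OF Cons.prems] by (auto simp: transf_set_def)
    have "(\<lambda>u. tl (e i (x # u))) \<in> transf_set A"
      by (rule sec) (rule e_S[OF Cons.prems])
    then have "transf B (d (\<lambda>u. tl (e i (x # u)))) u = tl (e i (x # u))"
      using Cons.IH d_S by presburger
    then show ?case
      by (simp add: B_def q)
  qed
  have "states B = S"
    by (simp add: B_def)
  have "S \<noteq> {}"
    using A fin by (auto simp: S_def mealy_automaton_def transf_set_def)
  then have "mealy_automaton B"
    using d_S(1) sec e_S by (auto simp: mealy_automaton_def B_def S_def)
  moreover have "transf B ` S = e ` S"
    using B_transf by (intro image_cong) auto
  then have "equivalent_automata B A"
    using e \<open>states B = S\<close>
    by (simp add: equivalent_automata_def transf_set_def[of B] S_def bij_betw_def)
  moreover have "card (states B) = card (transf_set A)"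
    by (simp add: B_def S_def)
  moreover have "card (transf_set A) \<le> card (states B')"
    if "mealy_automaton B'" "equivalent_automata B' A" for B' :: "(nat, 'x) mealy"
    using that by (metis card_image_le equivalent_automata_def mealy_automaton_def transf_set_def)
  ultimately show ?thesis
    unfolding minimal_state_count_def by (intro Least_equality) blast+
qed

lemma growth_function_eq:
  assumes "mealy_automaton A"
  shows "growth_function A n = card (act A ` {w. length w = n \<and> set w \<subseteq> states A})"
  unfolding growth_function_def minimal_state_count_eq[OF mealy_automaton_power[OF assms]]
    transf_set_def transf_power[abs_def]
  by (simp add: power_automaton_def)

lemma automaton_semigroup_eq: "automaton_semigroup A = act A ` sg_words (states A)"
proof
  show "automaton_semigroup A \<subseteq> act A ` sg_words (states A)"
  proof
    fix f assume "f \<in> automaton_semigroup A"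
    then show "f \<in> act A ` sg_words (states A)"
      unfolding automaton_semigroup_def
    proof induction
      case (gen g)
      then obtain q where "q \<in> states A" "g = act A [q]"
        by (auto simp: transf_set_def)
      then show ?case
        by (intro image_eqI[of _ _ "[q]"]) (auto simp: sg_words_def)
    next
      case (mult f g)
      then obtain v w where "f = act A v" "g = act A w" "v \<in> sg_words (states A)"
        "w \<in> sg_words (states A)"
        by blast
      then show ?case
        by (intro image_eqI[of _ _ "v @ w"]) (auto simp: sg_words_def act_append)
    qed
  qed
  have "act A w \<in> automaton_semigroup A" if "w \<noteq> []" "set w \<subseteq> states A" for w
    using that
  proof (induction w rule: list_nonempty_induct)
    case (single q)
    then show ?case
      by (auto simp: automaton_semigroup_def transf_set_def intro: generated_semigroup.gen)
  next
    case (cons q w)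
    then have "transf A q \<in> automaton_semigroup A"
      by (auto simp: automaton_semigroup_def transf_set_def intro: generated_semigroup.gen)
    moreover have "act A w \<in> automaton_semigroup A"
      using cons by simp
    ultimately have "transf A q \<circ> act A w \<in> automaton_semigroup A"
      unfolding automaton_semigroup_def by (rule generated_semigroup.mult)
    then show ?case
      by (simp only: act.simps)
  qed
  then show "act A ` sg_words (states A) \<subseteq> automaton_semigroup A"
    by (auto simp: sg_words_def)
qed

section \<open>Action on infinite words\<close>

primcorec stransf :: "('q, 'x::finite) mealy \<Rightarrow> 'q \<Rightarrow> 'x stream \<Rightarrow> 'x stream" where
  "stransf A q s = out A (shd s) q ## stransf A (trans A (shd s) q) (stl s)"

primrec sact :: "('q, 'x::finite) mealy \<Rightarrow> 'q list \<Rightarrow> 'x stream \<Rightarrow> 'x stream" where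
  "sact A [] = id"
| "sact A (q # w) = stransf A q \<circ> sact A w"

lemma sact_append: "sact A (v @ w) s = sact A v (sact A w s)"
  by (induction v) auto

lemma stake_stransf: "stake n (stransf A q s) = transf A q (stake n s)"
  by (induction n arbitrary: q s) auto

lemma stake_sact: "stake n (sact A w s) = act A w (stake n s)"
  by (induction w) (auto simp: stake_stransf)

text \<open>Each letter of the image of a stream is determined by the action on a finite prefix, so
  two products are distinct as soon as they differ on a single stream.\<close>

lemma sact_eqI:
  assumes "act A v = act A w"
  shows "sact A v s = sact A w s"
proof -
  have "sact A v s !! n = sact A w s !! n" for n
    using assms by (metis lessI stake_nth stake_sact)
  then show ?thesis
    by (metis smap_alt stream.map_id)
qed

section \<open>Separation of the normal forms\<close>

abbreviation rep :: "nat \<Rightarrow> 'a \<Rightarrow> 'a stream \<Rightarrow> 'a stream" where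
  "rep n x s \<equiv> replicate n x @- s"

definition zeros :: "letter stream" where
  "zeros = sconst X0"

lemma X0_zeros [simp]: "X0 ## zeros = zeros"
  by (metis id_apply siterate.code zeros_def)

lemma rep_zeros [simp]: "rep n X0 zeros = zeros"
  by (induction n) auto

text \<open>The length of the initial run of \<open>x\<close>, the letter that ends it and the
  remainder can be read off from the stream; the later comparisons of run lengths rest on
  this.\<close>

lemma rep_cong_iff:
  assumes "y \<noteq> x" "y' \<noteq> x"
  shows "rep m x (y ## s) = rep n x (y' ## t) \<longleftrightarrow> m = n \<and> y = y' \<and> s = t"
proof (induction m arbitrary: n)
  case 0
  show ?case using assms by (cases n) auto
next
  case (Suc m)
  show ?case using assms Suc by (cases n) auto
qed

abbreviation f0 :: "letter stream \<Rightarrow> letter stream" where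
  "f0 \<equiv> stransf A4 Q0"

abbreviation f1 :: "letter stream \<Rightarrow> letter stream" where
  "f1 \<equiv> stransf A4 Q1"

lemma A4_stransf [simp]:
  "f0 (X0 ## s) = X0 ## f0 s"
  "f0 (X1 ## s) = X0 ## f0 s"
  "f0 (X2 ## s) = X1 ## f0 s"
  "f0 (X3 ## s) = X1 ## f0 s"
  "f1 (X0 ## s) = X2 ## f0 s"
  "f1 (X1 ## s) = X3 ## f1 s"
  "f1 (X2 ## s) = X0 ## f1 s"
  "f1 (X3 ## s) = X1 ## f1 s"
  by (subst stransf.code; simp add: A4_def)+

lemma stransf_rep [simp]:
  "f0 (rep n X0 s) = rep n X0 (f0 s)"
  "f0 (rep n X1 s) = rep n X0 (f0 s)"
  "f0 (rep n X2 s) = rep n X1 (f0 s)"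
  "f0 (rep n X3 s) = rep n X1 (f0 s)"
  "f1 (rep n X1 s) = rep n X3 (f1 s)"
  "f1 (rep n X3 s) = rep n X1 (f1 s)"
  by (induction n; simp)+

lemma f0_zeros [simp]: "f0 zeros = zeros"
proof (coinduction)
  case Eq_stream
  have "zeros = X0 ## zeros"
    by simp
  then show ?case
    by (metis A4_stransf(1) stream.sel)
qed

lemma f1_zeros [simp]: "f1 zeros = X2 ## zeros"
  by (subst X0_zeros[symmetric]) (simp del: X0_zeros)

lemma rep_append_same [simp]: "rep n x (x ## s) = rep (Suc n) x s"
  by (induction n) auto

section \<open>Normal forms and their values on the probes\<close>

datatype tail = T | T0 | T1 | T11

fun tail_word :: "tail \<Rightarrow> state list" where
  "tail_word T = []"
| "tail_word T0 = [Q0]"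
| "tail_word T1 = [Q1]"
| "tail_word T11 = [Q1, Q1]"

text \<open>Here \<open>core k t\<close> is \<open>(10)^(k+1) t\<close>: the exponent is shifted so
  that \<open>k\<close> ranges over all natural numbers.\<close>

primrec core :: "nat \<Rightarrow> tail \<Rightarrow> state list" where
  "core 0 t = Q1 # Q0 # tail_word t"
| "core (Suc k) t = Q1 # Q0 # core k t"

datatype normal_form =
    Ones nat
  | Zero_Ones nat
  | Zero_Zero
  | Core nat nat tail
  | Zero_Core nat tail
  | Zero_Odd_Core nat nat tail

text \<open>The shift in \<open>Ones\<close> excludes the empty word. Between the initial
  \<open>0\<close> and the core only odd blocks of ones are listed: an even block joins the first
  \<open>1\<close> of the core to form an odd block between two zeros, which reduces to
  \<open>Zero_Core\<close>.\<close>

fun nf_word :: "normal_form \<Rightarrow> state list" where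
  "nf_word (Ones a) = replicate (Suc a) Q1"
| "nf_word (Zero_Ones b) = Q0 # replicate b Q1"
| "nf_word Zero_Zero = [Q0, Q0]"
| "nf_word (Core a k t) = replicate a Q1 @ core k t"
| "nf_word (Zero_Core k t) = Q0 # core k t"
| "nf_word (Zero_Odd_Core c k t) = Q0 # replicate (2 * c + 1) Q1 @ core k t"

text \<open>The three probes are the streams \<open>0\<^sup>\<omega>\<close>, \<open>20\<^sup>\<omega>\<close> and \<open>220\<^sup>\<omega>\<close>; after \<open>core k t\<close>, what remains of
  a probe is the length of its initial run of \<open>3\<close>s.\<close>

abbreviation probe :: "nat \<Rightarrow> letter stream" where
  "probe i \<equiv> rep i X2 zeros"

fun tail_shift :: "nat \<Rightarrow> tail \<Rightarrow> nat" where
  "tail_shift i T = i"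
| "tail_shift i T0 = 0"
| "tail_shift i T1 = (if i = 0 then 1 else 0)"
| "tail_shift i T11 = (if i = 0 then 0 else 1)"

text \<open>On \<open>X3^m X2\<close> followed by zeros, \<open>f0\<close> gives
  \<open>X1^(m+1)\<close> followed by zeros, and then \<open>f1\<close> gives
  \<open>X3^(m+1) X2\<close> followed by zeros. So each further factor \<open>10\<close> adds one to
  the run.\<close>

lemma sact_core:
  assumes "i \<in> {0, 1, 2}"
  shows "sact A4 (core k t) (probe i) = rep (k + tail_shift i t) X3 (X2 ## zeros)"
proof (induction k)
  case 0
  show ?case
    using assms by (cases t) (auto simp: numeral_2_eq_2)
next
  case (Suc k)
  then show ?case by simp
qed

definition run :: "nat \<Rightarrow> nat \<Rightarrow> letter stream" where
  "run a m = sact A4 (replicate a Q1) (rep m X3 (X2 ## zeros))"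

lemma run_Suc: "run (Suc a) m = f1 (run a m)"
  by (simp add: run_def)

text \<open>Two applications of \<open>f1\<close> restore the initial run and the letter
  \<open>X2\<close>. In between \<open>X0\<close> stands in its place, and reading \<open>X0\<close>
  sends \<open>Q1\<close> to \<open>Q0\<close>; the inner run of \<open>X3\<close> and its final
  \<open>X2\<close> then become a run of \<open>X1\<close> that is one letter longer than
  before.\<close>

lemma run_even_odd:
  "run (2 * c) m = rep m X3 (X2 ## rep c X1 zeros)"
  "run (Suc (2 * c)) m = rep m X1 (X0 ## rep c X3 (X2 ## zeros))"
proof -
  show even: "run (2 * c) m = rep m X3 (X2 ## rep c X1 zeros)" for c
  proof (induction c)
    case 0
    show ?case by (simp add: run_def)
  next
    case (Suc c)
    then show ?case by (simp add: run_Suc)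
  qed
  show "run (Suc (2 * c)) m = rep m X1 (X0 ## rep c X3 (X2 ## zeros))"
    by (simp add: run_Suc even)
qed

lemma rep_X1_zeros_iff: "rep c X1 zeros = rep d X1 zeros \<longleftrightarrow> c = d"
  using rep_cong_iff[of X0 X1 X0 c zeros d zeros] by simp

text \<open>The first letter shows the parity of \<open>a\<close>; the lengths of the outer and the
  inner run then give \<open>m\<close> and half of \<open>a\<close>.\<close>

lemma run_inj:
  assumes "run a m = run b n"
  shows "a = b \<and> m = n"
proof -
  have head: "shd (run a m) \<in> {X2, X3} \<longleftrightarrow> even a" for a m
    by (cases m; cases "even a") (auto simp: run_even_odd elim!: evenE oddE)
  then have "even a \<longleftrightarrow> even b"
    using assms by metis
  then show ?thesis
    using assms
    by (cases "even a")
      (auto simp: run_even_odd rep_cong_iff rep_X1_zeros_iff elim!: evenE oddE)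
qed

lemma X2_run: "X2 \<in> sset (run a m)"
  by (cases "even a") (auto simp: run_even_odd elim!: evenE oddE)

lemma X2_f0: "X2 \<notin> sset (f0 s)"
proof -
  have "f0 s = smap (\<lambda>x. A4_out x Q0) s" for s
    by (coinduction arbitrary: s) (auto simp: A4_def)
  moreover have "A4_out x Q0 \<noteq> X2" for x
    by (cases x) auto
  ultimately show ?thesis
    by (metis image_iff stream.set_map)
qed

text \<open>An even exponent is forgotten and an odd one survives in the length of the run of
  \<open>X1\<close>, in accordance with the forms \<open>Zero_Core\<close> and
  \<open>Zero_Odd_Core\<close>.\<close>

lemma f0_run:
  "f0 (run (2 * c) m) = rep (Suc m) X1 zeros"
  "f0 (run (Suc (2 * c)) m) = rep (Suc m) X0 (rep (Suc c) X1 zeros)"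
  unfolding run_even_odd by simp_all

lemma f0_run_0: "f0 (run 0 m) = rep (Suc m) X1 zeros"
  using f0_run(1)[of 0] by simp

lemma sact_core_words:
  fixes i :: nat
  assumes "i \<in> {0, 1, 2}"
  shows
    "sact A4 (nf_word (Core a k t)) (probe i) = run a (k + tail_shift i t)"
    "sact A4 (nf_word (Zero_Core k t)) (probe i) = f0 (run 0 (k + tail_shift i t))"
    "sact A4 (nf_word (Zero_Odd_Core c k t)) (probe i) = f0 (run (Suc (2 * c)) (k + tail_shift i t))"
  using sact_core[OF assms] by (simp_all add: sact_append run_def)

text \<open>\<open>probe 1\<close> is \<open>run 0 0\<close>, whereas \<open>probe 0\<close> reaches
  it only after one application of \<open>f1\<close>; hence the shift of the first argument of
  \<open>run\<close> between the two probes.\<close>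

lemma sact_ones_words:
  "sact A4 (nf_word (Ones a)) (probe 0) = run a 0"
  "sact A4 (nf_word (Ones a)) (probe 1) = run (Suc a) 0"
  "sact A4 (nf_word (Zero_Ones (2 * b))) (probe 0) = X0 ## rep b X1 zeros"
  "sact A4 (nf_word (Zero_Ones (Suc (2 * b)))) (probe 0) = X1 ## zeros"
  "sact A4 (nf_word (Zero_Ones c)) (probe 1) = f0 (run c 0)"
proof -
  have 0: "sact A4 (replicate (Suc a) Q1) zeros = run a 0" for a
    by (simp add: run_def sact_append flip: replicate_append_same)
  have 1: "sact A4 (replicate a Q1) (X2 ## zeros) = run a 0" for a
    by (simp add: run_def)
  show "sact A4 (nf_word (Ones a)) (probe 0) = run a 0"
    using 0 by simp
  show "sact A4 (nf_word (Ones a)) (probe 1) = run (Suc a) 0"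
    using 1[of "Suc a"] by simp
  show "sact A4 (nf_word (Zero_Ones (2 * b))) (probe 0) = X0 ## rep b X1 zeros"
    \<comment> \<open>The subtractions are exact for positive \<open>b\<close>; for
      \<open>b = 0\<close> the word is \<open>0\<close> and both sides are zeros.\<close>
    using 0[of "2 * b - 1"] f0_run(2)[of "b - 1"] by (cases b) auto
  show "sact A4 (nf_word (Zero_Ones (Suc (2 * b)))) (probe 0) = X1 ## zeros"
    using 0[of "2 * b"] f0_run(1)[of b] by simp
  show "sact A4 (nf_word (Zero_Ones c)) (probe 1) = f0 (run c 0)"
    using 1[of c] by simp
qed

text \<open>For \<open>i = 0, 1, 2\<close> the shifts are \<open>0, 1, 2\<close> for
  \<open>T\<close>, \<open>0, 0, 0\<close> for \<open>T0\<close>, \<open>1, 0, 0\<close> for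
  \<open>T1\<close> and \<open>0, 1, 1\<close> for \<open>T11\<close>. No two of these rows differ
  by a constant, and only the third probe tells \<open>T\<close> from \<open>T11\<close>.\<close>

lemma tail_shift_inj:
  assumes "\<And>i. i \<in> {0, 1, 2} \<Longrightarrow> k + tail_shift i t = l + tail_shift i u"
  shows "k = l \<and> t = u"
  using assms[of 0] assms[of 1] assms[of 2] by (cases t; cases u) auto

text \<open>The letter \<open>X2\<close> occurs in the image of \<open>probe 0\<close> exactly for
  the forms beginning with \<open>1\<close>. Among the others, \<open>Zero_Ones\<close> is
  recognised by different first letters on \<open>probe 0\<close> and \<open>probe 1\<close>. Within
  each class the run lengths give the parameters.\<close>

lemma nf_word_separated:
  assumes "act A4 (nf_word x) = act A4 (nf_word y)"
  shows "x = y"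
proof -
  define S where "S i z = sact A4 (nf_word z) (probe i)" for i z
  have eq: "S i x = S i y" for i
    unfolding S_def by (rule sact_eqI[OF assms])
  have core:
    "S i (Core a k t) = run a (k + tail_shift i t)"
    "S i (Zero_Core k t) = rep (Suc (k + tail_shift i t)) X1 zeros"
    "S i (Zero_Odd_Core c k t) = rep (Suc (k + tail_shift i t)) X0 (rep (Suc c) X1 zeros)"
    if "i \<in> {0, 1, 2}" for i a k t c
    unfolding S_def sact_core_words[OF that] f0_run f0_run_0 by simp_all
  have ones:
    "S 0 (Ones a) = run a 0" "S 1 (Ones a) = run (Suc a) 0"
    "S 0 (Zero_Ones (2 * b)) = X0 ## rep b X1 zeros"
    "S 0 (Zero_Ones (Suc (2 * b))) = X1 ## zeros"
    "S 1 (Zero_Ones (2 * b)) = X1 ## zeros"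
    "S 1 (Zero_Ones (Suc (2 * b))) = X0 ## rep (Suc b) X1 zeros" for a b
    unfolding S_def sact_ones_words f0_run by simp_all
  have zero_zero: "S 0 Zero_Zero = zeros" "S 1 Zero_Zero = zeros"
    by (simp_all add: S_def)
  note S = core[of 0] core[of 1] ones zero_zero
  have par: "(\<exists>c. b = 2 * c) \<or> (\<exists>c. b = Suc (2 * c))" for b :: nat
    by presburger
  have X2: "X2 \<in> sset (S 0 z) \<longleftrightarrow> (\<exists>a. z = Ones a) \<or> (\<exists>a k t. z = Core a k t)" for z
    using X2_f0 X2_f0[of zeros] X2_run unfolding S_def
    by (cases z) (auto simp: sact_core_words[of 0, simplified] sact_ones_words[simplified])
  have shd: "shd (S 0 z) = shd (S 1 z) \<longleftrightarrow> \<not> (\<exists>b. z = Zero_Ones b)"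
    if "X2 \<notin> sset (S 0 z)" for z
  proof (cases z)
    case (Zero_Ones b)
    then show ?thesis using par[of b] by (auto simp: S S[unfolded One_nat_def])
  qed (use that in \<open>auto simp: S S[unfolded One_nat_def] X2_run\<close>)
  have X1_X0: "rep (Suc m) X1 s \<noteq> zeros" "rep (Suc m) X1 s \<noteq> rep (Suc n) X0 t"
    "rep (Suc n) X0 (rep (Suc c) X1 s) \<noteq> zeros" for m n c s t
  proof -
    have "X1 \<notin> sset zeros"
      by (simp add: zeros_def)
    moreover have "X1 \<in> sset (rep (Suc m) X1 s)" "X1 \<in> sset (rep (Suc n) X0 (rep (Suc c) X1 s))"
      by auto
    ultimately show "rep (Suc m) X1 s \<noteq> zeros" "rep (Suc n) X0 (rep (Suc c) X1 s) \<noteq> zeros"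
      by metis+
  qed simp
  have odd_core: "m = n \<and> c = d"
    if "rep (Suc m) X0 (rep (Suc c) X1 zeros) = rep (Suc n) X0 (rep (Suc d) X1 zeros)" for m n c d
    using that rep_cong_iff[of X1 X0 X1 "Suc m" "rep c X1 zeros" "Suc n" "rep d X1 zeros"]
    by (simp add: rep_X1_zeros_iff)
  consider (one) "X2 \<in> sset (S 0 x)" | (zero_ones) "X2 \<notin> sset (S 0 x)" "shd (S 0 x) \<noteq> shd (S 1 x)"
    | (zero) "X2 \<notin> sset (S 0 x)" "shd (S 0 x) = shd (S 1 x)"
    by blast
  then show ?thesis
  proof cases
    case one
    then have one_y: "X2 \<in> sset (S 0 y)"
      by (simp add: eq)
    \<comment> \<open>From \<open>probe 0\<close> to \<open>probe 1\<close> the first argument of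
      \<open>run\<close> stays the same for \<open>Core\<close> but grows by one for
      \<open>Ones\<close>.\<close>
    have mixed: False if "S 0 (Core a k t) = S 0 (Ones b)" "S 1 (Core a k t) = S 1 (Ones b)" for a k t b
      using that by (auto simp: S S[unfolded One_nat_def] dest!: run_inj)
    have cores: "Core a k t = Core b l u" if "\<And>i. S i (Core a k t) = S i (Core b l u)" for a k t b l u
    proof -
      have "a = b \<and> k + tail_shift i t = l + tail_shift i u" if "i \<in> {0, 1, 2}" for i
        using \<open>\<And>i. S i (Core a k t) = S i (Core b l u)\<close>[of i] core(1)[OF that] run_inj by metis
      then show ?thesis
        using tail_shift_inj[of k t l u] by auto
    qed
    have oness: "a = b" if "S 0 (Ones a) = S 0 (Ones b)" for a b
      using that by (auto simp: S dest!: run_inj)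
    from one one_y show ?thesis
      unfolding X2 using eq mixed cores oness by metis
  next
    case zero_ones
    then obtain b c where "x = Zero_Ones b" "y = Zero_Ones c"
      using shd eq by metis
    moreover have "b = c" if "S 0 (Zero_Ones b) = S 0 (Zero_Ones c)" "S 1 (Zero_Ones b) = S 1 (Zero_Ones c)"
      using that par[of b] par[of c] by (auto simp: S S[unfolded One_nat_def] rep_X1_zeros_iff)
    ultimately show ?thesis
      using eq by metis
  next
    case zero
    then have zero_y: "X2 \<notin> sset (S 0 y)" "shd (S 0 y) = shd (S 1 y)"
      by (simp_all add: eq)
    have zero_cores: "Zero_Core k t = Zero_Core l u" if "\<And>i. S i (Zero_Core k t) = S i (Zero_Core l u)"
      for k t l u
    proof -
      have "k + tail_shift i t = l + tail_shift i u" if "i \<in> {0, 1, 2}" for i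
        using \<open>\<And>i. S i (Zero_Core k t) = S i (Zero_Core l u)\<close>[of i] core(2)[OF that]
          rep_X1_zeros_iff by (metis Suc_inject)
      then show ?thesis
        using tail_shift_inj[of k t l u] by auto
    qed
    have odd_cores: "Zero_Odd_Core c k t = Zero_Odd_Core d l u"
      if "\<And>i. S i (Zero_Odd_Core c k t) = S i (Zero_Odd_Core d l u)" for c k t d l u
    proof -
      have "c = d \<and> k + tail_shift i t = l + tail_shift i u" if "i \<in> {0, 1, 2}" for i
        using \<open>\<And>i. S i (Zero_Odd_Core c k t) = S i (Zero_Odd_Core d l u)\<close>[of i] core(3)[OF that]
          odd_core by metis
      then show ?thesis
        using tail_shift_inj[of k t l u] by auto
    qed
    have mixed: "S 0 (Zero_Core k t) \<noteq> S 0 (Zero_Odd_Core d l u)" "S 0 (Zero_Core k t) \<noteq> S 0 Zero_Zero"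
      "S 0 (Zero_Odd_Core d l u) \<noteq> S 0 Zero_Zero" for k t d l u
      unfolding S using X1_X0 by (simp_all add: core)
    have "x \<noteq> Ones a" "y \<noteq> Ones a" "x \<noteq> Core a k t" "y \<noteq> Core a k t"
      "x \<noteq> Zero_Ones a" "y \<noteq> Zero_Ones a" for a k t
      using zero zero_y X2 shd by blast+
    then show ?thesis
      using eq zero_cores odd_cores mixed mixed[symmetric] by (cases x; cases y) metis+
  qed
qed

section \<open>Reduction to normal form\<close>

declare sg_congruence.trans [trans]

lemma sg_congruence_sg_words:
  assumes "(u, v) \<in> sg_congruence G R" "R \<subseteq> sg_words G \<times> sg_words G"
  shows "u \<in> sg_words G \<and> v \<in> sg_words G"
  using assms by induction (auto simp: sg_words_def)

text \<open>The closure rules multiply by nonempty words only, so empty contexts are treated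
  separately.\<close>

lemma sg_congruence_context:
  assumes "(u, v) \<in> sg_congruence G R" "set x \<subseteq> G" "set y \<subseteq> G"
  shows "(x @ u @ y, x @ v @ y) \<in> sg_congruence G R"
proof -
  have "(u @ y, v @ y) \<in> sg_congruence G R"
    using assms by (cases "y = []") (auto simp: sg_words_def intro: sg_congruence.right)
  then show ?thesis
    using assms by (cases "x = []") (auto simp: sg_words_def intro: sg_congruence.left)
qed

lemma sg_congruence_mono:
  assumes "R \<subseteq> R'"
  shows "sg_congruence G R \<subseteq> sg_congruence G R'"
proof
  fix p assume "p \<in> sg_congruence G R"
  moreover have "(u, v) \<in> sg_congruence G R'" if "(u, v) \<in> sg_congruence G R" for u v
    using that assms by induction (auto intro: sg_congruence.intros)
  ultimately show "p \<in> sg_congruence G R'"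
    by (cases p) blast
qed

lemma states_UNIV: "{Q0, Q1} = (UNIV :: state set)"
  using state.exhaust by auto

abbreviation A4_cong :: "state list \<Rightarrow> state list \<Rightarrow> bool"  (infix \<open>\<approx>\<close> 50) where
  "u \<approx> v \<equiv> (u, v) \<in> sg_congruence {Q0, Q1} A4_relations"

lemma cong_refl: "u \<noteq> [] \<Longrightarrow> u \<approx> u"
  by (auto simp: sg_words_def states_UNIV intro: sg_congruence.refl)

lemma cong_context: "u \<approx> v \<Longrightarrow> x @ u @ y \<approx> x @ v @ y"
  by (rule sg_congruence_context) (auto simp: states_UNIV)

lemma cong_append: "u \<approx> v \<Longrightarrow> u @ y \<approx> v @ y"
  using cong_context[of u v "[]" y] by simp

lemma cong_Cons: "u \<approx> v \<Longrightarrow> q # u \<approx> q # v"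
  using cong_context[of u v "[q]" "[]"] by simp

lemma cong_zero_zero: "Q0 # Q0 # w \<approx> [Q0, Q0]"
proof (induction w)
  case Nil
  show ?case by (rule cong_refl) simp
next
  case (Cons q w)
  have "([Q0, Q0, q], [Q0, Q0]) \<in> A4_relations"
    by (cases q) (auto simp: A4_relations_def)
  then have "[Q0, Q0, q] @ w \<approx> [Q0, Q0] @ w"
    by (intro cong_append sg_congruence.base)
  then show ?case
    using Cons.IH by (auto intro: sg_congruence.trans)
qed

lemma cong_one_zero: "Q1 # Q0 # replicate (2 * d) Q1 @ q # w \<approx> Q1 # Q0 # q # w"
proof (induction d)
  case 0
  show ?case by (simp add: cong_refl)
next
  case (Suc d)
  have rel: "([Q1, Q0, Q1, Q1, q], [Q1, Q0, q]) \<in> A4_relations" for q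
    by (cases q) (auto simp: A4_relations_def)
  then have step: "Q1 # Q0 # Q1 # Q1 # q # w \<approx> Q1 # Q0 # q # w" for q w
    using cong_append[OF sg_congruence.base[OF rel[of q]], of w] by simp
  \<comment> \<open>The relation erases \<open>11\<close> only in front of a further letter; the
    letter \<open>q\<close> ensures that there is one.\<close>
  obtain q' w' where "replicate (2 * d) Q1 @ q # w = q' # w'"
    by (cases d) auto
  then have "Q1 # Q0 # replicate (2 * Suc d) Q1 @ q # w \<approx> Q1 # Q0 # replicate (2 * d) Q1 @ q # w"
    using step[of q' w'] by simp
  also note Suc.IH
  finally show ?case .
qed

lemma cong_zero_one_zero: "Q0 # replicate (Suc (2 * p)) Q1 @ Q0 # w \<approx> Q0 # Q1 # Q0 # w"
proof (cases "p = 0")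
  case False
  then have "([Q0] @ replicate (2 * p + 1) Q1 @ [Q0], [Q0, Q1, Q0]) \<in> A4_relations"
    by (auto simp: A4_relations_def)
  from cong_append[OF sg_congruence.base[OF this], of w] show ?thesis
    by simp
qed (simp add: cong_refl)

lemma A4_rel_sg_words: "A4_relations \<subseteq> sg_words {Q0, Q1} \<times> sg_words {Q0, Q1}"
  by (auto simp: A4_relations_def sg_words_def)

text \<open>Words are reduced from right to left, so it suffices to multiply normal forms by one
  generator on the left. The last clause covers the forms beginning with \<open>0\<close>, which
  become \<open>00\<close> by absorption.\<close>

fun prepend :: "state \<Rightarrow> normal_form \<Rightarrow> normal_form" where
  "prepend Q1 (Ones a) = Ones (Suc a)"
| "prepend Q1 (Zero_Ones b) = Core 0 0 (if b = 0 then T else if odd b then T1 else T11)"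
| "prepend Q1 Zero_Zero = Core 0 0 T0"
| "prepend Q1 (Core a k t) = Core (Suc a) k t"
| "prepend Q1 (Zero_Core k t) = Core 0 (Suc k) t"
| "prepend Q1 (Zero_Odd_Core c k t) = Core 0 0 T0"
| "prepend Q0 (Ones a) = Zero_Ones (Suc a)"
| "prepend Q0 (Core a k t) = (if even a then Zero_Core k t else Zero_Odd_Core (a div 2) k t)"
| "prepend Q0 _ = Zero_Zero"

lemma core_decomp: "\<exists>r. core k t = Q1 # Q0 # r"
  by (cases k) auto

lemma nf_word_prepend: "q # nf_word x \<approx> nf_word (prepend q x)"
proof (cases q)
  case Q0
  \<comment> \<open>The even block and the first \<open>1\<close> of the core form an odd block
    between two zeros.\<close>
  have even: "Q0 # replicate a Q1 @ core k t \<approx> Q0 # core k t" if "even a" for a k t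
  proof -
    obtain r where "core k t = Q1 # Q0 # r"
      using core_decomp by blast
    moreover obtain b where "a = 2 * b"
      using \<open>even a\<close> by (auto elim: evenE)
    ultimately have "Q0 # replicate a Q1 @ core k t = Q0 # replicate (Suc (2 * b)) Q1 @ Q0 # r"
      by (simp add: replicate_app_Cons_same)
    then show ?thesis
      using cong_zero_one_zero[of b r] \<open>core k t = Q1 # Q0 # r\<close> by metis
  qed
  show ?thesis
    unfolding Q0 by (cases x) (auto simp: even cong_zero_zero intro!: cong_refl elim!: oddE)
next
  case Q1
  have ones: "Q1 # Q0 # replicate b Q1 \<approx> nf_word (prepend Q1 (Zero_Ones b))" for b
  proof (cases "b = 0")
    case True
    then show ?thesis by (auto intro: cong_refl)
  next
    case False
    show ?thesis
    proof (cases "odd b")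
      case True
      then obtain d where "b = Suc (2 * d)"
        by (auto elim: oddE)
      then show ?thesis
        using cong_one_zero[of d Q1 "[]"] by (simp add: replicate_append_same)
    next
      case even: False
      then obtain d where "b = Suc (Suc (2 * d))"
        using False by (auto elim!: evenE) (metis Suc_pred' mult_Suc_right add_2_eq_Suc)
      then show ?thesis
        using cong_one_zero[of d Q1 "[Q1]"] by (simp add: replicate_app_Cons_same)
    qed
  qed
  \<comment> \<open>The odd block and the first \<open>1\<close> of the core form an even block
    after \<open>10\<close>. Erasing it leaves \<open>100\<close>, which absorbs the rest.\<close>
  have odd_core: "Q1 # Q0 # replicate (Suc (2 * c)) Q1 @ core k t \<approx> [Q1, Q0, Q0]" for c k t
  proof -
    obtain r where r: "core k t = Q1 # Q0 # r"
      using core_decomp by blast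
    have "Q1 # Q0 # replicate (Suc (2 * c)) Q1 @ core k t = Q1 # Q0 # replicate (2 * Suc c) Q1 @ Q0 # r"
      by (simp add: r replicate_app_Cons_same)
    also have "Q1 # Q0 # replicate (2 * Suc c) Q1 @ Q0 # r \<approx> Q1 # Q0 # Q0 # r"
      by (rule cong_one_zero)
    also have "Q1 # Q0 # Q0 # r \<approx> [Q1, Q0, Q0]"
      by (intro cong_Cons cong_zero_zero)
    finally show ?thesis .
  qed
  show ?thesis
    unfolding Q1 using ones odd_core by (cases x) (auto intro: cong_refl)
qed

section \<open>Lengths of the words with a given normal form\<close>

fun ends_zero_zero :: "normal_form \<Rightarrow> bool" where
  "ends_zero_zero Zero_Zero = True"
| "ends_zero_zero (Core a k t) = (t = T0)"
| "ends_zero_zero (Zero_Core k t) = (t = T0)"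
| "ends_zero_zero (Zero_Odd_Core c k t) = (t = T0)"
| "ends_zero_zero _ = False"

fun expandable :: "normal_form \<Rightarrow> bool" where
  "expandable (Core a k t) = (k \<noteq> 0 \<or> t \<noteq> T)"
| "expandable (Zero_Core k t) = True"
| "expandable (Zero_Odd_Core c k t) = (k \<noteq> 0 \<or> t \<noteq> T)"
| "expandable _ = False"

text \<open>Inserting \<open>11\<close> after a factor \<open>10\<close> that is not a suffix, or replacing \<open>010\<close> by
  \<open>01\<^bsup>2p+1\<^esup>0\<close>, lengthens a word by an even number of letters; a final \<open>00\<close> can be lengthened freely.
  So these are the normal forms of the words of length \<open>n\<close>.\<close>

definition attained :: "nat \<Rightarrow> normal_form set" where
  "attained n = {x. length (nf_word x) = n \<or> length (nf_word x) \<le> n \<and>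
     (ends_zero_zero x \<or> expandable x \<and> even (n - length (nf_word x)))}"

lemma core_not_Nil [simp]: "core k t \<noteq> []"
  using core_decomp[of k t] by auto

lemma length_core [simp]: "length (core k t) = 2 * k + 2 + length (tail_word t)"
  by (induction k) auto

text \<open>Whenever \<open>prepend\<close> shortens the word, either an even number of letters is
  lost and the result is expandable, or the result ends in \<open>00\<close>. Both properties
  survive further letters on the left, except that \<open>prepend\<close> may pass to a form ending
  in \<open>00\<close>.\<close>

lemma prepend_attained:
  assumes "x \<in> attained n"
  shows "prepend q x \<in> attained (Suc n)"
proof (cases q)
  case Q0
  with assms show ?thesis
    unfolding attained_def by (cases x) (auto elim!: oddE)
next
  case Q1
  with assms show ?thesis
    unfolding attained_def by (cases x) (auto elim!: oddE, presburger+)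
qed


text \<open>\<open>cong_one_zero\<close> is read backwards at the first \<open>10\<close>. The
  condition ensures that a letter follows this factor.\<close>

lemma cong_core_expand:
  assumes "k \<noteq> 0 \<or> t \<noteq> T"
  shows "\<exists>w. length w = length (core k t) + 2 * d \<and> w \<approx> core k t"
proof -
  obtain r where r: "core k t = Q1 # Q0 # r"
    using core_decomp by blast
  then have "r \<noteq> []"
    using assms by (cases k; cases t) auto
  then obtain q r' where qr: "core k t = Q1 # Q0 # q # r'"
    using r by (cases r) auto
  have "length (Q1 # Q0 # replicate (2 * d) Q1 @ q # r') = length (core k t) + 2 * d"
    by (simp only: qr) simp
  moreover have "Q1 # Q0 # replicate (2 * d) Q1 @ q # r' \<approx> core k t"
    using cong_one_zero qr by metis
  ultimately show ?thesis by blast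
qed

lemma nf_word_expand:
  assumes "x \<in> attained n"
  shows "\<exists>w. length w = n \<and> w \<approx> nf_word x"
proof -
  consider "length (nf_word x) = n" | (zero) "length (nf_word x) \<le> n" "ends_zero_zero x"
    | (even) d where "n = length (nf_word x) + 2 * d" "expandable x"
  proof -
    have "\<exists>d. n = length (nf_word x) + 2 * d"
      if "length (nf_word x) \<le> n" "even (n - length (nf_word x))"
      using that by presburger
    then show ?thesis
      using assms that unfolding attained_def by blast
  qed
  then show ?thesis
  proof cases
    case 1
    have "nf_word x \<noteq> []"
      by (cases x) auto
    with 1 show ?thesis
      using cong_refl by blast
  next
    case zero
    have "\<exists>p. core k T0 = p @ [Q0, Q0]" for k
      by (induction k) auto
    then have *: "\<exists>p. q @ core k T0 = p @ [Q0, Q0]" for q k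
      by (metis append_assoc)
    have "\<exists>p. nf_word x = p @ [Q0, Q0]"
    proof (cases x)
      case (Core a k t)
      then show ?thesis using zero(2) *[of "replicate a Q1" k] by simp
    next
      case (Zero_Core k t)
      then show ?thesis using zero(2) *[of "[Q0]" k] by simp
    next
      case (Zero_Odd_Core c k t)
      then show ?thesis using zero(2) *[of "Q0 # replicate (2 * c + 1) Q1" k] by simp
    qed (use zero(2) in auto)
    then obtain p where p: "nf_word x = p @ [Q0, Q0]" ..
    \<comment> \<open>The final \<open>00\<close> absorbs the padding zeros.\<close>
    have "nf_word x @ replicate (n - length (nf_word x)) Q0 \<approx> nf_word x"
      unfolding p using cong_context[OF cong_zero_zero, of p _ "[]"] by simp
    then show ?thesis
      using zero(1)
      by (intro exI[of _ "nf_word x @ replicate (n - length (nf_word x)) Q0"]) simp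
  next
    case even
    have *: "\<exists>w'. length w' = length (p @ core k t) + 2 * d \<and> w' \<approx> p @ core k t"
      if "k \<noteq> 0 \<or> t \<noteq> T" for p k t
    proof -
      obtain w where "length w = length (core k t) + 2 * d" "w \<approx> core k t"
        using cong_core_expand[of k t d] \<open>k \<noteq> 0 \<or> t \<noteq> T\<close> by blast
      then show ?thesis
        using cong_context[of w "core k t" p "[]"] by (intro exI[of _ "p @ w"]) auto
    qed
    show ?thesis
    proof (cases x)
      case (Core a k t)
      then show ?thesis using *[of k t "replicate a Q1"] even by simp
    next
      case (Zero_Odd_Core c k t)
      then show ?thesis using *[of k t "Q0 # replicate (2 * c + 1) Q1"] even by simp
    next
      case (Zero_Core k t)
      obtain r where r: "core k t = Q1 # Q0 # r"
        using core_decomp by blast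
      \<comment> \<open>Here the initial \<open>010\<close> is stretched, which works even when no
        letter follows it.\<close>
      have "Q0 # replicate (Suc (2 * d)) Q1 @ Q0 # r \<approx> nf_word x"
        using cong_zero_one_zero Zero_Core r by simp
      moreover have "length (Q0 # replicate (Suc (2 * d)) Q1 @ Q0 # r) = n"
        using even Zero_Core r by (simp only: nf_word.simps) simp
      ultimately show ?thesis by blast
    qed (use even in auto)
  qed
qed

section \<open>Soundness and completeness of the relations\<close>

lemma act_eq_of_cong:
  assumes "\<And>u v. (u, v) \<in> R \<Longrightarrow> act A u = act A v" "(u, v) \<in> sg_congruence G R"
  shows "act A u = act A v"
  using assms(2) by induction (auto simp: assms(1) act_append)

lemma A4_simps: "out A4 = A4_out" "mealy.trans A4 = A4_trans"
  by (simp_all add: A4_def)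

lemma transf_Q0_binary:
  assumes "set u \<subseteq> {X0, X1}"
  shows "transf A4 Q0 u = replicate (length u) X0"
  using assms by (induction u) (auto simp: A4_simps)

lemma set_transf_Q0: "set (transf A4 Q0 u) \<subseteq> {X0, X1}"
proof (induction u)
  case (Cons x u)
  then show ?case by (cases x) (auto simp: A4_simps)
qed simp

text \<open>\<open>f0\<close> outputs only \<open>X0\<close> and \<open>X1\<close> and sends both to
  \<open>X0\<close>; its square is therefore constant on words of a given length.\<close>

lemma transf_Q0_Q0: "transf A4 Q0 (transf A4 Q0 u) = replicate (length u) X0"
  using transf_Q0_binary[OF set_transf_Q0] by simp

lemma transf_Q0_zeros: "transf A4 Q0 (replicate n X0) = replicate n X0"
  by (induction n) (auto simp: A4_simps)

text \<open>The first letters of both sides agree. What acts on the rest of the input then contains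
  the square of \<open>f0\<close> on both sides, except for \<open>q = Q1\<close> and first letter
  \<open>X1\<close>, where it is again the original pair.\<close>

lemma act_one_zero_one_one:
  "transf A4 Q1 (transf A4 Q0 (transf A4 Q1 (transf A4 Q1 (transf A4 q u))))
    = transf A4 Q1 (transf A4 Q0 (transf A4 q u))"
proof (cases q)
  case Q0
  have "transf A4 Q1 (transf A4 Q0 (transf A4 Q1 (transf A4 Q1 v))) = transf A4 Q1 (transf A4 Q0 v)"
    if "set v \<subseteq> {X0, X1}" for v
    using that by (cases v) (auto simp: A4_simps transf_Q0_Q0 transf_Q0_binary transf_Q0_zeros)
  then show ?thesis
    using set_transf_Q0 Q0 by blast
next
  case Q1
  show ?thesis
    unfolding Q1
  proof (induction u)
    case (Cons x u)
    then show ?case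
      by (cases x) (simp_all add: A4_simps transf_Q0_Q0 transf_Q0_zeros)
  qed simp
qed

lemma act_zero_odd_ones:
  assumes "set u \<subseteq> {X0, X1}"
  shows "transf A4 Q0 (act A4 (replicate (Suc (2 * p)) Q1) u) = transf A4 Q0 (transf A4 Q1 u)"
  using assms
proof (induction u)
  case Nil
  have "act A4 (replicate n Q1) [] = []" for n
    by (induction n) auto
  then show ?case by simp
next
  case (Cons x u)
  have X1: "act A4 (replicate (Suc (2 * p)) Q1) (X1 # u) = X3 # act A4 (replicate (Suc (2 * p)) Q1) u"
    by (induction p) (auto simp: A4_simps)
  \<comment> \<open>The first \<open>f1\<close> reads \<open>X0\<close> and continues as
    \<open>f0\<close>. Each further pair of \<open>f1\<close> restores \<open>X2\<close>, and the
    outer one of the pair again continues as \<open>f0\<close>, so an outer \<open>f0\<close> turns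
    the remainder into zeros.\<close>
  have X0: "\<exists>v. act A4 (replicate (Suc (2 * p)) Q1) (X0 # u) = X2 # transf A4 Q0 v" for p
  proof (induction p)
    case (Suc p)
    then show ?case by (auto simp: A4_simps)
  qed (auto simp: A4_simps)
  obtain v where v: "act A4 (replicate (Suc (2 * p)) Q1) (X0 # u) = X2 # transf A4 Q0 v"
    using X0 by blast
  then have "length v = length u"
    by (metis length_Cons length_act length_transf nat.inject)
  from Cons.prems consider "x = X0" | "x = X1"
    by auto
  then show ?case
  proof cases
    case 1
    then show ?thesis
      using v \<open>length v = length u\<close> by (simp add: A4_simps transf_Q0_Q0 del: replicate_Suc)
  next
    case 2
    then show ?thesis
      using X1 Cons by (simp add: A4_simps del: replicate_Suc)
  qed
qed

lemma A4_relations_sound: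
  assumes "(u, v) \<in> A4_relations"
  shows "act A4 u = act A4 v"
proof
  fix s
  have "transf A4 Q0 (act A4 (replicate (Suc (2 * p)) Q1) (transf A4 Q0 s))
      = transf A4 Q0 (transf A4 Q1 (transf A4 Q0 s))" for p
    by (rule act_zero_odd_ones) (rule set_transf_Q0)
  moreover have "act A4 ([Q0] @ replicate (2 * p + 1) Q1 @ [Q0]) s
      = transf A4 Q0 (act A4 (replicate (Suc (2 * p)) Q1) (transf A4 Q0 s))" for p
    by (simp only: act_append) simp
  ultimately show "act A4 u s = act A4 v s"
    using assms act_one_zero_one_one
    by (auto simp: A4_relations_def transf_Q0_Q0 transf_Q0_zeros simp del: replicate_Suc)
qed

lemma act_A4_cong: "u \<approx> v \<Longrightarrow> act A4 u = act A4 v"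
  by (rule act_eq_of_cong[OF A4_relations_sound])

lemma cong_nf_word:
  assumes "w \<noteq> []"
  shows "\<exists>x \<in> attained (length w). w \<approx> nf_word x"
  using assms
proof (induction w rule: list_nonempty_induct)
  case (single q)
  have "[q] \<approx> [q]"
    by (rule cong_refl) simp
  moreover have "\<exists>x. length (nf_word x) = 1 \<and> nf_word x = [q]"
  proof (cases q)
    case Q0
    then show ?thesis by (intro exI[of _ "Zero_Ones 0"]) simp
  next
    case Q1
    then show ?thesis by (intro exI[of _ "Ones 0"]) simp
  qed
  then have "\<exists>x \<in> attained 1. nf_word x = [q]"
    by (auto simp: attained_def)
  ultimately have "\<exists>x \<in> attained 1. [q] \<approx> nf_word x"
    by metis
  then show ?case by simp
next
  case (cons q w)
  then obtain x where x: "x \<in> attained (length w)" "w \<approx> nf_word x"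
    by blast
  have "q # w \<approx> q # nf_word x"
    using x(2) by (rule cong_Cons)
  also have "q # nf_word x \<approx> nf_word (prepend q x)"
    by (rule nf_word_prepend)
  finally show ?case
    using prepend_attained[OF x(1), of q] by auto
qed

text \<open>Completeness: both words are congruent to normal forms, soundness makes these act
  equally, and separation makes them equal.\<close>

lemma act_A4_eq_iff:
  assumes "u \<noteq> []" "v \<noteq> []"
  shows "act A4 u = act A4 v \<longleftrightarrow> u \<approx> v"
proof
  assume eq: "act A4 u = act A4 v"
  obtain x y where "u \<approx> nf_word x" "v \<approx> nf_word y"
    using assms cong_nf_word by meson
  then have "x = y"
    using nf_word_separated act_A4_cong eq by metis
  then show "u \<approx> v"
    using \<open>u \<approx> nf_word x\<close> \<open>v \<approx> nf_word y\<close> sg_congruence.sym sg_congruence.trans by metis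
qed (rule act_A4_cong)

lemma growth_A4_eq:
  assumes "n \<ge> 1"
  shows "growth_function A4 n = card (attained n)"
proof -
  have "act A4 ` {w. length w = n} = (\<lambda>x. act A4 (nf_word x)) ` attained n"
  proof (intro equalityI image_subsetI)
    fix w assume "w \<in> {w :: state list. length w = n}"
    then show "act A4 w \<in> (\<lambda>x. act A4 (nf_word x)) ` attained n"
      using assms cong_nf_word[of w] act_A4_cong by force
  next
    fix x assume "x \<in> attained n"
    then show "act A4 (nf_word x) \<in> act A4 ` {w. length w = n}"
      using nf_word_expand act_A4_cong by (metis (mono_tags) image_eqI mem_Collect_eq)
  qed
  moreover have "states A4 = UNIV"
    by (simp add: A4_def states_UNIV)
  moreover have "card ((\<lambda>x. act A4 (nf_word x)) ` attained n) = card (attained n)"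
    by (rule card_image) (auto intro: inj_onI nf_word_separated)
  ultimately show ?thesis
    by (simp add: growth_function_eq[OF A4_mealy_automaton])
qed

section \<open>Counting\<close>

lemma card_disjoint_list:
  assumes "sorted_wrt (\<lambda>A B. A \<inter> B = {}) As" "\<forall>A \<in> set As. finite A"
  shows "card (\<Union> (set As)) = sum_list (map card As)"
  using assms
proof (induction As)
  case (Cons A As)
  then have "A \<inter> \<Union> (set As) = {}"
    by auto
  moreover have "finite A" "finite (\<Union> (set As))"
    using Cons.prems by auto
  ultimately have "card (A \<union> \<Union> (set As)) = card A + card (\<Union> (set As))"
    by (intro card_Un_disjoint)
  then show ?case
    using Cons by simp
qed simp

definition triangle :: "(nat \<Rightarrow> nat \<Rightarrow> 'a) \<Rightarrow> nat \<Rightarrow> 'a set" where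
  "triangle f m = {f i k | i k. i + k < m}"

text \<open>Passing from \<open>m\<close> to \<open>Suc m\<close> adds the diagonal
  \<open>i + k = m\<close>, which has \<open>m + 1\<close> elements.\<close>

lemma finite_card_triangle:
  assumes "\<And>i k i' k'. f i k = f i' k' \<Longrightarrow> i = i' \<and> k = k'"
  shows "finite (triangle f m) \<and> 2 * card (triangle f m) = m * (m + 1)"
proof (induction m)
  case 0
  show ?case by (simp add: triangle_def)
next
  case (Suc m)
  have "triangle f (Suc m) = triangle f m \<union> (\<lambda>i. f i (m - i)) ` {..m}"
  proof -
    have "i + k < Suc m \<longleftrightarrow> i + k < m \<or> i \<le> m \<and> k = m - i" for i k
      by auto
    then show ?thesis
      unfolding triangle_def by blast
  qed
  moreover have "triangle f m \<inter> (\<lambda>i. f i (m - i)) ` {..m} = {}"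
    using assms by (fastforce simp: triangle_def)
  moreover have "card ((\<lambda>i. f i (m - i)) ` {..m}) = Suc m"
    using assms by (subst card_image) (auto intro: inj_onI)
  ultimately show ?case
    using Suc by (auto simp: card_Un_disjoint)
qed

lemma card_triangle_eq:
  assumes "\<And>i k i' k'. f i k = f i' k' \<Longrightarrow> i = i' \<and> k = k'"
  shows "real (card (triangle f m)) = real m * (real m + 1) / 2"
proof -
  have "real (2 * card (triangle f m)) = real (m * (m + 1))"
    using finite_card_triangle[of f m] assms by metis
  then show ?thesis by (simp add: algebra_simps)
qed

lemma card_triangles:
  "real (card (triangle (\<lambda>i k. Core (2 * i) k t) m)) = real m * (real m + 1) / 2"
  "real (card (triangle (\<lambda>i k. Core (2 * i) (Suc k) t) m)) = real m * (real m + 1) / 2"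
  "real (card (triangle (\<lambda>i k. Core (Suc (2 * i)) k t) m)) = real m * (real m + 1) / 2"
  "real (card (triangle (\<lambda>i k. Core (Suc (2 * i)) (Suc k) t) m)) = real m * (real m + 1) / 2"
  "real (card (triangle (\<lambda>i k. Zero_Odd_Core i k t) m)) = real m * (real m + 1) / 2"
  "real (card (triangle (\<lambda>i k. Zero_Odd_Core i (Suc k) t) m)) = real m * (real m + 1) / 2"
  by (rule card_triangle_eq; simp)+

text \<open>The first set collects \<open>Zero_Zero\<close> and the forms that occur only with exact
  length. In \<open>Core\<close> the tails \<open>T\<close>, \<open>T1\<close> and
  \<open>T11\<close> force the parity of \<open>a\<close>, while \<open>T0\<close> admits both
  parities because \<open>00\<close> absorbs any number of letters. Halving \<open>a\<close> turns
  each length bound into a triangle.\<close>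

lemma card_attained_even:
  "real (card (attained (2 * m + 4))) = 4 * real (m + 2) ^ 2 - 5 * real (m + 2) + 6"
proof -
  let ?As = "[{Ones (2 * m + 3), Zero_Ones (2 * m + 3), Zero_Zero, Core (2 * m + 2) 0 T,
        Zero_Odd_Core m 0 T},
      triangle (\<lambda>i k. Core (2 * i) (Suc k) T) (Suc m),
      triangle (\<lambda>i k. Core (2 * i + 1) k T1) (Suc m),
      triangle (\<lambda>i k. Core (2 * i) k T11) (Suc m),
      triangle (\<lambda>i k. Core (2 * i) k T0) (Suc m),
      triangle (\<lambda>i k. Core (2 * i + 1) k T0) (Suc m),
      (\<lambda>k. Zero_Core k T1) ` {..m},
      (\<lambda>k. Zero_Core k T0) ` {..m},
      triangle (\<lambda>i k. Zero_Odd_Core i (Suc k) T) m,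
      triangle (\<lambda>i k. Zero_Odd_Core i k T11) m,
      triangle (\<lambda>i k. Zero_Odd_Core i k T0) m]"
  have parity: "2 * i \<noteq> Suc (2 * j)" for i j :: nat
    by presburger
  have mem:
    "Core a 0 T \<in> attained (2 * m + 4) \<longleftrightarrow> a = 2 * m + 2"
    "Core a (Suc k) T \<in> attained (2 * m + 4) \<longleftrightarrow> (\<exists>i. a = 2 * i \<and> i + k < Suc m)"
    "Core a k T1 \<in> attained (2 * m + 4) \<longleftrightarrow> (\<exists>i. a = 2 * i + 1 \<and> i + k < Suc m)"
    "Core a k T11 \<in> attained (2 * m + 4) \<longleftrightarrow> (\<exists>i. a = 2 * i \<and> i + k < Suc m)"
    "Core a k T0 \<in> attained (2 * m + 4) \<longleftrightarrow> (\<exists>i. (a = 2 * i \<or> a = 2 * i + 1) \<and> i + k < Suc m)"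
    "Zero_Core k T \<notin> attained (2 * m + 4)"
    "Zero_Core k T11 \<notin> attained (2 * m + 4)"
    "Zero_Core k T1 \<in> attained (2 * m + 4) \<longleftrightarrow> k \<le> m"
    "Zero_Core k T0 \<in> attained (2 * m + 4) \<longleftrightarrow> k \<le> m"
    "Zero_Odd_Core c 0 T \<in> attained (2 * m + 4) \<longleftrightarrow> c = m"
    "Zero_Odd_Core c (Suc k) T \<in> attained (2 * m + 4) \<longleftrightarrow> c + k < m"
    "Zero_Odd_Core c k T1 \<notin> attained (2 * m + 4)"
    "Zero_Odd_Core c k T11 \<in> attained (2 * m + 4) \<longleftrightarrow> c + k < m"
    "Zero_Odd_Core c k T0 \<in> attained (2 * m + 4) \<longleftrightarrow> c + k < m" for a c k
    by (simp add: attained_def; presburger)+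
  have "x \<in> attained (2 * m + 4) \<longleftrightarrow> x \<in> \<Union> (set ?As)" for x
  proof (cases x)
    case (Core a k t)
    then show ?thesis
      by (cases t; cases k) (auto simp: mem triangle_def)
  next
    case (Zero_Core k t)
    then show ?thesis
      by (cases t) (auto simp: mem triangle_def)
  next
    case (Zero_Odd_Core c k t)
    then show ?thesis
      by (cases t; cases k) (auto simp: mem triangle_def)
  qed (auto simp: attained_def triangle_def)
  then have "attained (2 * m + 4) = \<Union> (set ?As)"
    by blast
  moreover have "card (\<Union> (set ?As)) = sum_list (map card ?As)"
  proof (rule card_disjoint_list)
    show "sorted_wrt (\<lambda>A B. A \<inter> B = {}) ?As"
      by (auto simp: triangle_def parity parity[symmetric])
    show "\<forall>A \<in> set ?As. finite A"
      by (auto intro!: finite_card_triangle[THEN conjunct1])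
  qed
  moreover have "real (sum_list (map card ?As)) = 4 * real (m + 2) ^ 2 - 5 * real (m + 2) + 6"
    by (simp add: card_triangles card_image inj_on_def) (simp add: power2_eq_square field_simps)
  ultimately show ?thesis by simp
qed

text \<open>For odd length the parities of \<open>a\<close> are exchanged, and only the tails
  \<open>T1\<close> and \<open>T0\<close> remain in \<open>Zero_Odd_Core\<close>.\<close>

lemma card_attained_odd:
  "real (card (attained (2 * m + 3))) = 7 / 2 * real (m + 1) ^ 2 + 3 / 2 * real (m + 1) + 2"
proof -
  let ?As = "[{Ones (2 * m + 2), Zero_Ones (2 * m + 2), Zero_Zero, Core (2 * m + 1) 0 T},
      triangle (\<lambda>i k. Core (2 * i + 1) (Suc k) T) m,
      triangle (\<lambda>i k. Core (2 * i) k T1) (Suc m),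
      triangle (\<lambda>i k. Core (2 * i + 1) k T11) m,
      triangle (\<lambda>i k. Core (2 * i) k T0) (Suc m),
      triangle (\<lambda>i k. Core (2 * i + 1) k T0) m,
      (\<lambda>k. Zero_Core k T) ` {..m},
      (\<lambda>k. Zero_Core k T11) ` {..<m},
      (\<lambda>k. Zero_Core k T0) ` {..<m},
      triangle (\<lambda>i k. Zero_Odd_Core i k T1) m,
      triangle (\<lambda>i k. Zero_Odd_Core i k T0) m]"
  have parity: "2 * i \<noteq> Suc (2 * j)" for i j :: nat
    by presburger
  have mem:
    "Core a 0 T \<in> attained (2 * m + 3) \<longleftrightarrow> a = 2 * m + 1"
    "Core a (Suc k) T \<in> attained (2 * m + 3) \<longleftrightarrow> (\<exists>i. a = 2 * i + 1 \<and> i + k < m)"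
    "Core a k T1 \<in> attained (2 * m + 3) \<longleftrightarrow> (\<exists>i. a = 2 * i \<and> i + k < Suc m)"
    "Core a k T11 \<in> attained (2 * m + 3) \<longleftrightarrow> (\<exists>i. a = 2 * i + 1 \<and> i + k < m)"
    "Core a k T0 \<in> attained (2 * m + 3) \<longleftrightarrow>
      (\<exists>i. a = 2 * i \<and> i + k < Suc m \<or> a = 2 * i + 1 \<and> i + k < m)"
    "Zero_Core k T \<in> attained (2 * m + 3) \<longleftrightarrow> k \<le> m"
    "Zero_Core k T11 \<in> attained (2 * m + 3) \<longleftrightarrow> k < m"
    "Zero_Core k T1 \<notin> attained (2 * m + 3)"
    "Zero_Core k T0 \<in> attained (2 * m + 3) \<longleftrightarrow> k < m"
    "Zero_Odd_Core c k T \<notin> attained (2 * m + 3)"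
    "Zero_Odd_Core c k T1 \<in> attained (2 * m + 3) \<longleftrightarrow> c + k < m"
    "Zero_Odd_Core c k T11 \<notin> attained (2 * m + 3)"
    "Zero_Odd_Core c k T0 \<in> attained (2 * m + 3) \<longleftrightarrow> c + k < m" for a c k
    by (simp add: attained_def; presburger)+
  have "x \<in> attained (2 * m + 3) \<longleftrightarrow> x \<in> \<Union> (set ?As)" for x
  proof (cases x)
    case (Core a k t)
    then show ?thesis
      by (cases t; cases k) (auto simp: mem triangle_def)
  next
    case (Zero_Core k t)
    then show ?thesis
      by (cases t) (auto simp: mem triangle_def)
  next
    case (Zero_Odd_Core c k t)
    then show ?thesis
      by (cases t; cases k) (auto simp: mem triangle_def)
  qed (auto simp: attained_def triangle_def)
  then have "attained (2 * m + 3) = \<Union> (set ?As)"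
    by blast
  moreover have "card (\<Union> (set ?As)) = sum_list (map card ?As)"
  proof (rule card_disjoint_list)
    show "sorted_wrt (\<lambda>A B. A \<inter> B = {}) ?As"
      by (auto simp: triangle_def parity parity[symmetric])
    show "\<forall>A \<in> set ?As. finite A"
      by (auto intro!: finite_card_triangle[THEN conjunct1])
  qed
  moreover have "real (sum_list (map card ?As)) = 7 / 2 * real (m + 1) ^ 2 + 3 / 2 * real (m + 1) + 2"
    by (simp add: card_triangles card_image inj_on_def) (simp add: power2_eq_square field_simps)
  ultimately show ?thesis by simp
qed

lemma attained_1: "attained 1 = {Ones 0, Zero_Ones 0}"
proof -
  have "x \<in> attained 1 \<longleftrightarrow> x \<in> {Ones 0, Zero_Ones 0}" for x
    by (cases x) (auto simp: attained_def)
  then show ?thesis by blast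
qed

text \<open>The even formula would give 5 here; the form \<open>Zero_Odd_Core m 0 T\<close> counted
  there has length at least 4 and is absent.\<close>

lemma attained_2: "attained 2 = {Ones 1, Zero_Ones 1, Zero_Zero, Core 0 0 T}"
proof -
  have "x \<in> attained 2 \<longleftrightarrow> x \<in> {Ones 1, Zero_Ones 1, Zero_Zero, Core 0 0 T}" for x
    by (cases x; auto simp: attained_def; rename_tac t; case_tac t; auto)
  then show ?thesis by blast
qed

lemma growth_A4_even:
  assumes "n \<ge> 2"
  shows "real (growth_function A4 (2 * n)) = 4 * real n ^ 2 - 5 * real n + 6"
proof -
  obtain m where "n = m + 2"
    using assms by (metis add.commute le_Suc_ex)
  then show ?thesis
    using card_attained_even[of m] growth_A4_eq[of "2 * m + 4"]
    by (simp only: distrib_left) simp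
qed

lemma growth_A4_odd: "real (growth_function A4 (2 * n + 1)) = 7 / 2 * real n ^ 2 + 3 / 2 * real n + 2"
proof (cases n)
  case 0
  then show ?thesis
    using growth_A4_eq[of 1] attained_1 by simp
next
  case (Suc m)
  then show ?thesis
    using card_attained_odd[of m] growth_A4_eq[of "2 * m + 3"] by (simp add: numeral_3_eq_3)
qed

lemma growth_A4_2: "growth_function A4 2 = 4"
  using growth_A4_eq[of 2] attained_2 by simp

section \<open>Presentations\<close>

lemma singleton_sg_words: "g \<in> G \<Longrightarrow> [g] \<in> sg_words G"
  by (simp add: sg_words_def)

lemma equiv_sg_congruence:
  assumes "R \<subseteq> sg_words G \<times> sg_words G"
  shows "equiv (sg_words G) (sg_congruence G R)"
proof (rule equivI)
  show "sg_congruence G R \<subseteq> sg_words G \<times> sg_words G"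
    using sg_congruence_sg_words[OF _ assms] by auto
  show "refl_on (sg_words G) (sg_congruence G R)"
    by (auto simp: refl_on_def intro: sg_congruence.refl)
  show "sym (sg_congruence G R)"
    by (intro symI) (rule sg_congruence.sym)
  show "Relation.trans (sg_congruence G R)"
    by (intro transI) (rule sg_congruence.trans)
qed

lemma has_sg_presentation_act:
  assumes R: "R \<subseteq> sg_words (states A) \<times> sg_words (states A)"
    and eq: "\<And>u v. u \<in> sg_words (states A) \<Longrightarrow> v \<in> sg_words (states A) \<Longrightarrow>
      act A u = act A v \<longleftrightarrow> (u, v) \<in> sg_congruence (states A) R"
  shows "has_sg_presentation (automaton_semigroup A) (\<circ>) (transf A) (states A) R"
proof -
  let ?W = "sg_words (states A)" and ?C = "sg_congruence (states A) R"
  \<comment> \<open>Evaluation of an arbitrary representative; by \<open>eq\<close> the choice does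
    not affect the value.\<close>
  define h where "h = (\<lambda>c. act A (SOME w. w \<in> c))"
  have equiv: "equiv ?W ?C"
    by (rule equiv_sg_congruence[OF R])
  have h: "h (?C `` {w}) = act A w" if "w \<in> ?W" for w
  proof -
    have "w \<in> ?C `` {w}"
      using that by (auto intro: sg_congruence.refl)
    then have "(w, SOME v. v \<in> ?C `` {w}) \<in> ?C"
      by (metis Image_singleton_iff someI)
    then show ?thesis
      unfolding h_def by (subst eq) (use sg_congruence_sg_words[OF _ R] that in \<open>blast intro: sg_congruence.sym\<close>)+
  qed
  have "inj_on h (?W // ?C)"
  proof (rule inj_onI)
    fix c d assume "c \<in> ?W // ?C" "d \<in> ?W // ?C" "h c = h d"
    then obtain u v where "u \<in> ?W" "c = ?C `` {u}" "v \<in> ?W" "d = ?C `` {v}"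
      by (auto elim!: quotientE)
    moreover from this have "(u, v) \<in> ?C"
      using \<open>h c = h d\<close> h eq by simp
    ultimately show "c = d"
      using equiv_class_eq[OF equiv] by simp
  qed
  moreover have "h ` (?W // ?C) = act A ` ?W"
    using h by (auto simp: quotient_def image_UN)
  ultimately have "bij_betw h (?W // ?C) (automaton_semigroup A)"
    by (simp add: bij_betw_def automaton_semigroup_eq)
  moreover have "h (?C `` {u @ v}) = h (?C `` {u}) \<circ> h (?C `` {v})" if "u \<in> ?W" "v \<in> ?W" for u v
    using that h[of "u @ v"] h[of u] h[of v] by (auto simp: sg_words_def act_append)
  moreover have "h (?C `` {[q]}) = transf A q" if "q \<in> states A" for q
    using that h[of "[q]"] by (simp add: sg_words_def)
  ultimately show ?thesis
    using R unfolding has_sg_presentation_def by blast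
qed

text \<open>A finite presentation over any generating set involves, after rewriting its generators as
  words over \<open>G\<close>, only finitely many consequences of the directed union of the \<open>R P\<close>; hence a
  single \<open>R P\<close> already presents the semigroup.\<close>

lemma finitely_presented_directed_union:
  fixes h :: "'g list \<Rightarrow> 's" and R :: "nat \<Rightarrow> ('g list \<times> 'g list) set"
  assumes fp: "finitely_presented_sg S mult"
    and onto: "h ` sg_words G = S"
    and hom: "\<And>u v. u \<in> sg_words G \<Longrightarrow> v \<in> sg_words G \<Longrightarrow> h (u @ v) = mult (h u) (h v)"
    and ker: "\<And>u v. u \<in> sg_words G \<Longrightarrow> v \<in> sg_words G \<Longrightarrow>
      h u = h v \<longleftrightarrow> (\<exists>P. (u, v) \<in> sg_congruence G (R P))"
    and "mono R" and "finite G"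
  obtains P where "\<And>u v. u \<in> sg_words G \<Longrightarrow> v \<in> sg_words G \<Longrightarrow> h u = h v \<Longrightarrow>
    (u, v) \<in> sg_congruence G (R P)"
proof -
  obtain \<phi> :: "nat \<Rightarrow> 's" and H Q where "finite H" "finite Q"
    and pres: "has_sg_presentation S mult \<phi> H Q"
    using fp unfolding finitely_presented_sg_def by blast
  then obtain k where Q: "Q \<subseteq> sg_words H \<times> sg_words H"
    and k_bij: "bij_betw k (sg_words H // sg_congruence H Q) S"
    and k_mult: "\<And>u v. u \<in> sg_words H \<Longrightarrow> v \<in> sg_words H \<Longrightarrow>
      k (sg_congruence H Q `` {u @ v}) = mult (k (sg_congruence H Q `` {u})) (k (sg_congruence H Q `` {v}))"
    unfolding has_sg_presentation_def by blast
  note equiv = equiv_sg_congruence[OF Q]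
  define e where "e u = k (sg_congruence H Q `` {u})" for u
  have e_append: "e (u @ v) = mult (e u) (e v)" if "u \<in> sg_words H" "v \<in> sg_words H" for u v
    using k_mult that by (simp add: e_def)
  have e_S: "e u \<in> S" if "u \<in> sg_words H" for u
    using bij_betwE[OF k_bij] quotientI[OF that] unfolding e_def by blast
  have e_onto: "\<exists>u \<in> sg_words H. e u = s" if "s \<in> S" for s
  proof -
    obtain c where "c \<in> sg_words H // sg_congruence H Q" "k c = s"
      using bij_betw_imp_surj_on[OF k_bij] \<open>s \<in> S\<close> by blast
    then show ?thesis
      unfolding e_def by (auto elim!: quotientE)
  qed
  have e_eq: "e u = e v \<longleftrightarrow> (u, v) \<in> sg_congruence H Q" if "u \<in> sg_words H" "v \<in> sg_words H" for u v
  proof -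
    have "e u = e v \<longleftrightarrow> sg_congruence H Q `` {u} = sg_congruence H Q `` {v}"
      unfolding e_def
      by (rule inj_on_eq_iff[OF bij_betw_imp_inj_on[OF k_bij] quotientI[OF that(1)] quotientI[OF that(2)]])
    then show ?thesis
      using eq_equiv_class_iff[OF equiv that] by simp
  qed
  have "\<exists>w. w \<in> sg_words G \<and> h w = e [g]" if "g \<in> H" for g
    using e_S[OF singleton_sg_words[OF that]] unfolding onto[symmetric] by auto
  then obtain \<sigma> where \<sigma>: "\<And>g. g \<in> H \<Longrightarrow> \<sigma> g \<in> sg_words G" "\<And>g. g \<in> H \<Longrightarrow> h (\<sigma> g) = e [g]"
    by metis
  define sub where "sub u = concat (map \<sigma> u)" for u
  have sub_append: "sub (u @ v) = sub u @ sub v" for u v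
    by (simp add: sub_def)
  have sub: "sub u \<in> sg_words G \<and> h (sub u) = e u" if "u \<noteq> []" "set u \<subseteq> H" for u
    using that
  proof (induction u rule: list_nonempty_induct)
    case (single g)
    then show ?case using \<sigma> by (simp add: sub_def)
  next
    case (cons g u)
    then have "h (\<sigma> g @ sub u) = mult (e [g]) (e u)"
      using \<sigma> hom by simp
    also have "\<dots> = e (g # u)"
      using e_append[of "[g]" u] cons by (simp add: sg_words_def)
    finally show ?case
      using \<sigma>(1)[of g] cons by (auto simp: sub_def sg_words_def)
  qed
  have sub_G: "sub u \<in> sg_words G" and sub_h: "h (sub u) = e u" if "u \<in> sg_words H" for u
    using sub that by (auto simp: sg_words_def)
  have "\<exists>u. u \<in> sg_words H \<and> e u = h [g]" if "g \<in> G" for g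
    using e_onto[of "h [g]"] singleton_sg_words[OF that] onto by blast
  then obtain \<tau> where \<tau>: "\<And>g. g \<in> G \<Longrightarrow> \<tau> g \<in> sg_words H" "\<And>g. g \<in> G \<Longrightarrow> e (\<tau> g) = h [g]"
    by metis
  \<comment> \<open>These are the finitely many consequences needed: the relations of
    \<open>Q\<close> translated to \<open>G\<close>, and the fact that translating a generator of
    \<open>G\<close> to \<open>H\<close> and back gives the same element.\<close>
  define E where "E = (\<lambda>(u, v). (sub u, sub v)) ` Q \<union> (\<lambda>g. ([g], sub (\<tau> g))) ` G"
  have "finite E"
    using \<open>finite Q\<close> \<open>finite G\<close> by (simp add: E_def)
  moreover have "\<exists>P. p \<in> sg_congruence G (R P)" if "p \<in> E" for p
    using that unfolding E_def
  proof (elim UnE imageE; clarify)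
    fix u v assume "(u, v) \<in> Q"
    then have "u \<in> sg_words H" "v \<in> sg_words H" "(u, v) \<in> sg_congruence H Q"
      using Q by (auto intro: sg_congruence.base)
    moreover from this have "e u = e v"
      using e_eq by simp
    ultimately show "\<exists>P. (sub u, sub v) \<in> sg_congruence G (R P)"
      using ker sub_G sub_h by metis
  next
    fix g assume "g \<in> G"
    then show "\<exists>P. ([g], sub (\<tau> g)) \<in> sg_congruence G (R P)"
      using ker[of "[g]" "sub (\<tau> g)"] sub_G sub_h \<tau> by (auto simp: sg_words_def)
  qed
  ultimately have "\<exists>P. E \<subseteq> sg_congruence G (R P)"
  proof (induction E rule: finite_induct)
    case (insert p E)
    then obtain P P' where "E \<subseteq> sg_congruence G (R P)" "p \<in> sg_congruence G (R P')"
      by blast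
    moreover have "sg_congruence G (R P) \<subseteq> sg_congruence G (R (max P P'))"
      "sg_congruence G (R P') \<subseteq> sg_congruence G (R (max P P'))"
      by (intro sg_congruence_mono monoD[OF \<open>mono R\<close>]; simp)+
    ultimately show ?case by blast
  qed simp
  then obtain P where P: "E \<subseteq> sg_congruence G (R P)" ..
  have sub_cong: "(sub u, sub v) \<in> sg_congruence G (R P)" if "(u, v) \<in> sg_congruence H Q" for u v
    using that
  proof induction
    case (base u v)
    then show ?case using P by (auto simp: E_def)
  next
    case (refl u)
    then show ?case by (intro sg_congruence.refl sub_G)
  next
    case (sym u v)
    show ?case by (rule sg_congruence.sym[OF sym.IH])
  next
    case (trans u v w)
    then show ?case by (blast intro: sg_congruence.trans)
  next
    case (left u v w)
    then show ?case by (simp add: sub_append sg_congruence.left sub_G)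
  next
    case (right u v w)
    then show ?case by (simp add: sub_append sg_congruence.right sub_G)
  qed
  define subG where "subG w = concat (map \<tau> w)" for w
  have subG: "subG w \<in> sg_words H \<and> (w, sub (subG w)) \<in> sg_congruence G (R P) \<and> e (subG w) = h w"
    if "w \<noteq> []" "set w \<subseteq> G" for w
    using that
  proof (induction w rule: list_nonempty_induct)
    case (single g)
    then show ?case using \<tau> P by (auto simp: subG_def E_def)
  next
    case (cons g w)
    have g: "\<tau> g \<in> sg_words H" "e (\<tau> g) = h [g]" "([g], sub (\<tau> g)) \<in> sg_congruence G (R P)"
      using \<tau> P cons by (auto simp: E_def)
    have w: "subG w \<in> sg_words H" "(w, sub (subG w)) \<in> sg_congruence G (R P)" "e (subG w) = h w"
      using cons by auto
    have G: "[g] \<in> sg_words G" "w \<in> sg_words G"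
      using cons by (auto simp: sg_words_def)
    have "([g] @ w, [g] @ sub (subG w)) \<in> sg_congruence G (R P)"
      using w(2) G by (intro sg_congruence.left)
    also have "([g] @ sub (subG w), sub (\<tau> g) @ sub (subG w)) \<in> sg_congruence G (R P)"
      using g sub_G[OF w(1)] by (intro sg_congruence.right)
    finally have "(g # w, sub (subG (g # w))) \<in> sg_congruence G (R P)"
      by (simp add: subG_def sub_def)
    moreover have "e (subG (g # w)) = h (g # w)"
      using e_append[OF g(1) w(1)] hom[OF G] g w by (simp add: subG_def)
    moreover have "subG (g # w) \<in> sg_words H"
      using g w by (auto simp: sg_words_def subG_def)
    ultimately show ?case by blast
  qed
  show thesis
  proof
    fix u v assume uv: "u \<in> sg_words G" "v \<in> sg_words G" "h u = h v"
    then have u: "subG u \<in> sg_words H" "(u, sub (subG u)) \<in> sg_congruence G (R P)" "e (subG u) = h u"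
      and v: "subG v \<in> sg_words H" "(v, sub (subG v)) \<in> sg_congruence G (R P)" "e (subG v) = h v"
      using subG by (auto simp: sg_words_def)
    \<comment> \<open>The chain runs from \<open>u\<close> to \<open>sub (subG u)\<close>, then to
      \<open>sub (subG v)\<close> by translating a derivation over \<open>Q\<close>, and finally to
      \<open>v\<close>.\<close>
    then have "(subG u, subG v) \<in> sg_congruence H Q"
      using e_eq uv by metis
    then show "(u, v) \<in> sg_congruence G (R P)"
      using sub_cong u v sg_congruence.sym sg_congruence.trans by meson
  qed
qed

text \<open>No relation can be applied to \<open>w\<close> or lead to it. The context
  \<open>x\<close>, \<open>y\<close> is kept arbitrary so that multiplication on either side is
  absorbed into it.\<close>

lemma sg_congruence_isolated:
  assumes "(u, v) \<in> sg_congruence G R"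
    and "\<And>u v x y. (u, v) \<in> R \<Longrightarrow> x @ u @ y \<noteq> w \<and> x @ v @ y \<noteq> w"
  shows "x @ u @ y = w \<longleftrightarrow> x @ v @ y = w"
  using assms(1)
proof (induction arbitrary: x y)
  case (base u v)
  then show ?case using assms(2) by blast
next
  case (sym u v)
  show ?case using sym.IH[of x y] by (rule HOL.sym)
next
  case (trans u v z)
  show ?case using trans.IH(1)[of x y] trans.IH(2)[of x y] by (rule HOL.trans)
next
  case (left u v z)
  then show ?case using left.IH[of "x @ z" y] by simp
next
  case (right u v z)
  then show ?case using right.IH[of x "z @ y"] by simp
qed (rule HOL.refl)

section \<open>Truncated relations and a word they cannot change\<close>

definition A4_relations_upto :: "nat \<Rightarrow> (state list \<times> state list) set" where
  "A4_relations_upto P =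
     {([Q0, Q0, q], [Q0, Q0]) | q. q \<in> {Q0, Q1}} \<union>
     {([Q1, Q0, Q1, Q1, q], [Q1, Q0, q]) | q. q \<in> {Q0, Q1}} \<union>
     {([Q0] @ replicate (2 * p + 1) Q1 @ [Q0], [Q0, Q1, Q0]) | p. p \<ge> 1 \<and> p \<le> P}"

lemma A4_relations_upto_UN: "(\<Union>P. A4_relations_upto P) = A4_relations"
  by (auto simp: A4_relations_upto_def A4_relations_def)

lemma mono_A4_relations_upto: "mono A4_relations_upto"
  by (auto simp: mono_def A4_relations_upto_def)

text \<open>A derivation uses finitely many relations. Only transitivity combines two indices, and
  monotonicity provides a common one.\<close>

lemma sg_congruence_UN_mono:
  assumes "mono R" "(u, v) \<in> sg_congruence G (\<Union>P :: nat. R P)"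
  shows "\<exists>P. (u, v) \<in> sg_congruence G (R P)"
  using assms(2)
proof induction
  case (trans u v w)
  then obtain P P' where "(u, v) \<in> sg_congruence G (R P)" "(v, w) \<in> sg_congruence G (R P')"
    by blast
  moreover have "sg_congruence G (R P) \<subseteq> sg_congruence G (R (max P P'))"
    "sg_congruence G (R P') \<subseteq> sg_congruence G (R (max P P'))"
    by (intro sg_congruence_mono monoD[OF \<open>mono R\<close>]; simp)+
  ultimately show ?case
    by (blast intro: sg_congruence.trans)
next
  case (sym u v)
  then show ?case by (metis sg_congruence.sym)
qed (blast intro: sg_congruence.base sg_congruence.refl sg_congruence.left sg_congruence.right)+

lemma ones_zero_split:
  assumes "p @ Q0 # s = replicate b Q1 @ [Q0]"
  shows "p = replicate b Q1 \<and> s = []"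
  using assms
proof (induction b arbitrary: p)
  case 0
  then show ?case by (cases p) auto
next
  case (Suc b)
  then obtain p' where "p = Q1 # p'" "p' @ Q0 # s = replicate b Q1 @ [Q0]"
    by (cases p) auto
  then show ?case
    using Suc.IH[of p'] by simp
qed

text \<open>The only zeros of the right-hand word are its two ends, so a factor that starts and ends
  with \<open>0\<close> is the whole word.\<close>

lemma zero_ones_zero_factor:
  assumes "x @ Q0 # replicate a Q1 @ Q0 # y = Q0 # replicate b Q1 @ [Q0]"
  shows "a = b"
proof (cases x)
  case Nil
  then show ?thesis
    using assms ones_zero_split[of "replicate a Q1" y b] by simp
next
  case (Cons q x')
  then show ?thesis
    using assms ones_zero_split[of x' "replicate a Q1 @ Q0 # y" b] by simp
qed

text \<open>A zero preceded by a one is the last letter, so nothing can follow it.\<close>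

lemma one_zero_not_factor: "x @ Q1 # Q0 # q # y \<noteq> Q0 # replicate b Q1 @ [Q0]"
proof (cases x)
  case (Cons z x')
  then show ?thesis
    using ones_zero_split[of "x' @ [Q1]" "q # y" b] by auto
qed simp

text \<open>The block length \<open>2 * P + 3\<close> is the first odd one beyond the exponents in
  the truncated relations.\<close>

lemma A4_relations_upto_not_factor:
  assumes "(u, v) \<in> A4_relations_upto P"
  shows "x @ u @ y \<noteq> Q0 # replicate (2 * P + 3) Q1 @ [Q0] \<and>
    x @ v @ y \<noteq> Q0 # replicate (2 * P + 3) Q1 @ [Q0]"
proof -
  have zeros: "x @ Q0 # Q0 # z \<noteq> Q0 # replicate (2 * P + 3) Q1 @ [Q0]" for z
    using zero_ones_zero_factor[of x 0 z "2 * P + 3"] by auto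
  have ones: "x @ Q0 # replicate a Q1 @ Q0 # y \<noteq> Q0 # replicate (2 * P + 3) Q1 @ [Q0]"
    if "a < 2 * P + 3" for a
    using zero_ones_zero_factor[of x a y "2 * P + 3"] that by auto
  from assms consider (zz) q where "u = [Q0, Q0, q]" "v = [Q0, Q0]"
    | (oz) q where "u = [Q1, Q0, Q1, Q1, q]" "v = [Q1, Q0, q]"
    | (zoz) p where "u = [Q0] @ replicate (2 * p + 1) Q1 @ [Q0]" "v = [Q0, Q1, Q0]" "p \<le> P"
    unfolding A4_relations_upto_def by blast
  then show ?thesis
  proof cases
    case zz
    then show ?thesis using zeros by simp
  next
    case oz
    then show ?thesis
      using one_zero_not_factor[of x _ _ "2 * P + 3"] by (simp del: replicate_Suc)
  next
    case zoz
    then show ?thesis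
      using ones[of "2 * p + 1"] ones[of 1] by simp
  qed
qed

lemma not_finitely_presented_A4: "\<not> finitely_presented_sg (automaton_semigroup A4) (\<circ>)"
proof
  assume "finitely_presented_sg (automaton_semigroup A4) (\<circ>)"
  then obtain P where P: "\<And>u v. u \<in> sg_words {Q0, Q1} \<Longrightarrow> v \<in> sg_words {Q0, Q1} \<Longrightarrow>
    act A4 u = act A4 v \<Longrightarrow> (u, v) \<in> sg_congruence {Q0, Q1} (A4_relations_upto P)"
  proof (rule finitely_presented_directed_union)
    show "act A4 ` sg_words {Q0, Q1} = automaton_semigroup A4"
      by (simp add: automaton_semigroup_eq A4_def)
    fix u v :: "state list" assume uv: "u \<in> sg_words {Q0, Q1}" "v \<in> sg_words {Q0, Q1}"
    show "act A4 (u @ v) = act A4 u \<circ> act A4 v"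
      by (rule act_append)
    have "sg_congruence {Q0, Q1} (A4_relations_upto P) \<subseteq> sg_congruence {Q0, Q1} A4_relations" for P
      by (rule sg_congruence_mono) (use A4_relations_upto_UN in blast)
    moreover have "\<exists>P. (u, v) \<in> sg_congruence {Q0, Q1} (A4_relations_upto P)" if "u \<approx> v"
      using sg_congruence_UN_mono[OF mono_A4_relations_upto] that A4_relations_upto_UN by metis
    moreover have "act A4 u = act A4 v \<longleftrightarrow> u \<approx> v"
      using uv by (intro act_A4_eq_iff) (auto simp: sg_words_def)
    ultimately show "act A4 u = act A4 v \<longleftrightarrow> (\<exists>P. (u, v) \<in> sg_congruence {Q0, Q1} (A4_relations_upto P))"
      by blast
  qed (rule mono_A4_relations_upto, simp, blast)
  let ?w = "Q0 # replicate (2 * P + 3) Q1 @ [Q0]"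
  have "?w = Q0 # replicate (Suc (2 * (P + 1))) Q1 @ Q0 # []"
    by (simp add: numeral_3_eq_3)
  then have "?w \<approx> [Q0, Q1, Q0]"
    using cong_zero_one_zero[of "P + 1" "[]"] by metis
  then have "(?w, [Q0, Q1, Q0]) \<in> sg_congruence {Q0, Q1} (A4_relations_upto P)"
    by (intro P act_A4_cong) (auto simp: sg_words_def)
  from sg_congruence_isolated[OF this, of ?w "[]" "[]"] have "?w = [Q0, Q1, Q0]"
    using A4_relations_upto_not_factor by simp
  then show False
    by (simp add: numeral_3_eq_3)
qed

section \<open>Growth order\<close>

lemma growth_le_trans:
  assumes "growth_le f g" "growth_le g h"
  shows "growth_le f h"
proof -
  obtain C1 C2 N where C: "C1 > 0" "C2 > 0" "\<And>n. n \<ge> N \<Longrightarrow> f n \<le> C1 * g (C2 * n)"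
    using assms(1) unfolding growth_le_def by blast
  obtain D1 D2 M where D: "D1 > 0" "D2 > 0" "\<And>n. n \<ge> M \<Longrightarrow> g n \<le> D1 * h (D2 * n)"
    using assms(2) unfolding growth_le_def by blast
  have "f n \<le> (C1 * D1) * h ((D2 * C2) * n)" if "n \<ge> max N M" for n
  proof -
    have "n \<le> C2 * n"
      using C(2) by simp
    then have "C2 * n \<ge> M"
      using that by linarith
    then have "C1 * g (C2 * n) \<le> C1 * (D1 * h (D2 * (C2 * n)))"
      by (intro mult_left_mono D(3)) simp_all
    moreover have "f n \<le> C1 * g (C2 * n)"
      using C(3) that by simp
    ultimately show ?thesis
      unfolding mult.assoc by (rule order.trans[rotated])
  qed
  then show ?thesis
    unfolding growth_le_def using C(1,2) D(1,2) by (meson mult_pos_pos)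
qed

lemma growth_order_eqI:
  assumes "growth_equiv f g"
  shows "growth_order f = growth_order g"
  using assms growth_le_trans unfolding growth_order_def growth_equiv_def by blast

lemma growth_A4_quadratic:
  assumes "n \<ge> 3"
  shows "growth_function A4 n \<le> 2 * n ^ 2" "n ^ 2 \<le> 2 * growth_function A4 n"
proof -
  have "real (growth_function A4 n) \<le> 2 * real n ^ 2 \<and> real n ^ 2 \<le> 2 * real (growth_function A4 n)"
  proof (cases "even n")
    case True
    then obtain m where m: "n = 2 * m"
      by (elim evenE)
    then have "real m \<ge> 2"
      using assms by simp
    \<comment> \<open>The second square yields \<open>4 m^2 - 10 m + 12 \<ge> 0\<close>, which is
      the lower bound for \<open>n = 2 m\<close>.\<close>
    have "real m ^ 2 \<ge> 0" "(4 * real m - 5) ^ 2 \<ge> 0"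
      by simp_all
    then show ?thesis
      using growth_A4_even[of m] \<open>real m \<ge> 2\<close> m by (simp add: power2_eq_square algebra_simps)
  next
    case False
    then obtain m where m: "n = 2 * m + 1"
      by (elim oddE)
    have "real m * real m \<ge> real m"
      by (cases m) auto
    then show ?thesis
      using growth_A4_odd[of m] m by (simp add: power2_eq_square algebra_simps)
  qed
  then have "real (growth_function A4 n) \<le> real (2 * n ^ 2)" "real (n ^ 2) \<le> real (2 * growth_function A4 n)"
    by simp_all
  then show "growth_function A4 n \<le> 2 * n ^ 2" "n ^ 2 \<le> 2 * growth_function A4 n"
    by (simp_all only: of_nat_le_iff)
qed

lemma growth_order_A4: "growth_order (growth_function A4) = growth_order (\<lambda>n. n ^ 2)"
proof (rule growth_order_eqI)
  show "growth_equiv (growth_function A4) (\<lambda>n. n ^ 2)"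
    unfolding growth_equiv_def growth_le_def
    using growth_A4_quadratic by (intro conjI exI[of _ 2] exI[of _ 1] exI[of _ 3]) auto
qed

text \<open>The difference of the two formulas is \<open>n (n - 13) / 2 + 4\<close>, which is
  positive from \<open>n = 13\<close> on. These drops show both that the function is composite and
  that it is not non-decreasing.\<close>

lemma growth_A4_odd_less_even:
  assumes "n \<ge> 13"
  shows "growth_function A4 (2 * n + 1) < growth_function A4 (2 * n)"
proof -
  have "real n * real n \<ge> 13 * real n"
    using assms by (intro mult_right_mono) auto
  then have "real (growth_function A4 (2 * n + 1)) < real (growth_function A4 (2 * n))"
    using growth_A4_even[of n] growth_A4_odd[of n] assms unfolding power2_eq_square by linarith
  then show ?thesis by simp
qed

lemma composite_A4: "composite_function 2 (growth_function A4)"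
proof -
  have "\<not> eventually (\<lambda>n. growth_function A4 (2 * n + 0) = growth_function A4 (2 * n + 1)) sequentially"
  proof
    assume "eventually (\<lambda>n. growth_function A4 (2 * n + 0) = growth_function A4 (2 * n + 1)) sequentially"
    then obtain N where "\<And>n. n \<ge> N \<Longrightarrow> growth_function A4 (2 * n + 0) = growth_function A4 (2 * n + 1)"
      unfolding eventually_sequentially by blast
    from this[of "max N 13"] show False
      using growth_A4_odd_less_even[of "max N 13"] by simp
  qed
  then show ?thesis
    unfolding composite_function_def by (metis One_nat_def lessI numeral_2_eq_2 order_refl zero_less_Suc)
qed

theorem theorem4p3:
  shows "\<not> finitely_presented_sg (automaton_semigroup A4) (\<circ>) \<and>
         has_sg_presentation (automaton_semigroup A4) (\<circ>) (transf A4) {Q0, Q1} A4_relations \<and>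
         composite_function 2 (growth_function A4) \<and>
         \<not> mono (growth_function A4) \<and> \<not> antimono (growth_function A4) \<and>
         (\<forall>n \<ge> 2. real (growth_function A4 (2 * n)) = 4 * real n ^ 2 - 5 * real n + 6) \<and>
         (\<forall>n. real (growth_function A4 (2 * n + 1)) = 7 / 2 * real n ^ 2 + 3 / 2 * real n + 2) \<and>
         growth_function A4 2 = 4 \<and>
         growth_order (growth_function A4) = growth_order (\<lambda>n. n ^ 2)"
proof -
  have "has_sg_presentation (automaton_semigroup A4) (\<circ>) (transf A4) (states A4) A4_relations"
    by (rule has_sg_presentation_act)
      (use A4_rel_sg_words act_A4_eq_iff in \<open>auto simp: A4_def sg_words_def\<close>)
  then have "has_sg_presentation (automaton_semigroup A4) (\<circ>) (transf A4) {Q0, Q1} A4_relations"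
    by (simp add: A4_def)
  moreover have "\<not> mono (growth_function A4)"
    using growth_A4_odd_less_even[of 13] monoD[of "growth_function A4" 26 27] by force
  \<comment> \<open>The values at 1 and 3 are 2 and 7.\<close>
  moreover have "\<not> antimono (growth_function A4)"
    using growth_A4_odd[of 0] growth_A4_odd[of 1] antimonoD[of "growth_function A4" 1 3] by force
  ultimately show ?thesis
    using not_finitely_presented_A4 composite_A4 growth_A4_even growth_A4_odd growth_A4_2
      growth_order_A4 by blast
qed

end
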